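(* Let $\{C,C'\}$ be a 1-completable pair of maximal caps in $AG(4,3)$, and let $C'=C_1\cup R_1$ be the decomposition of $C'$ into two disjoint demicaps with $\Phi(\{C_1,R_1\})=C$. The demicap $C_1$ lies in exactly six maximal caps; let $R_1,\dots,R_6$ be the complements of $C_1$ in these six maximal caps. Likewise $R_1$ lies in exactly six maximal caps; let $C_1,\dots,C_6$ be the complements of $R_1$ in them. Then for all $1\le i,j\le 6$, $R_i\cup C_j$ is a maximal cap, and $\{R_i\cup C_j: 1\le i,j\le 6\}$ is exactly the set of $36$ maximal caps $K$ such that $\{C,K\}$ is a 1-completable pair.
   Context: $AG(4,3)$ is the affine space $\mathbb{F}_3^4$; a line is a set of three distinct points $\{x,y,z\}$ with $x+y+z=0$. A cap is a set of points containing no line; a maximal cap is a cap of largest possible size (in $AG(4,3)$ this size is $20$); every maximal cap has a unique anchor point $a\notin C$ such that $C$ is a union of pairs $\{b,c\}$ with $\{a,b,c\}$ a line. A hyperplane is a $3$-dimensional affine subspace; co-hyperplanar means contained in a common hyperplane. For a point $a$, an $a$-line is a pair $\{b,c\}$ with $\{a,b,c\}$ a line. A demicap with anchor point $a$ is a cap consisting of the $10$ points of five $a$-lines such that no four of these five $a$-lines are co-hyperplanar. For a set $S$ and $p\notin S$, $p$ completes a line with a pair of points of $S$ if there are distinct $x,y\in S$ with $\{p,x,y\}$ a line; the number of lines $p$ completes is the number of such unordered pairs. A partition (of the relevant kind) is a partition of $AG(4,3)$ into a singleton $\{a\}$ and four pairwise disjoint maximal caps each having anchor point $a$; two disjoint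 maximal caps form a $k$-completable pair if they occur together in exactly $k$ such partitions. For a maximal cap $K$ with anchor $a$ and a decomposition $K=E\cup E'$ into two disjoint demicaps, $\Phi(\{E,E'\})$ denotes the set of points $p\notin K\cup\{a\}$ that complete exactly one line with a pair of points of $E$ and exactly one line with a pair of points of $E'$. *)

theory Defs
  imports "HOL-Analysis.Analysis" "HOL-Library.Numeral_Type"
begin

text \<open>Points of AG(4,3) = F_3^4, modelled as vectors of length 4 over the field Z/3 (type 3).\<close>
type_synonym pt = "3 ^ 4"

definition is_line :: "pt set \<Rightarrow> bool" where
  "is_line L \<longleftrightarrow> (\<exists>x y z. L = {x, y, z} \<and> x \<noteq> y \<and> y \<noteq> z \<and> x \<noteq> z \<and> x + y + z = 0)"

definition is_cap :: "pt set \<Rightarrow> bool" where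
  "is_cap C \<longleftrightarrow> (\<forall>L. is_line L \<longrightarrow> \<not> L \<subseteq> C)"

definition max_cap :: "pt set \<Rightarrow> bool" where
  "max_cap C \<longleftrightarrow> is_cap C \<and> (\<forall>D. is_cap D \<longrightarrow> card D \<le> card C)"

definition a_line :: "pt \<Rightarrow> pt set \<Rightarrow> bool" where
  "a_line a P \<longleftrightarrow> (\<exists>b c. P = {b, c} \<and> is_line {a, b, c})"

definition anchor :: "pt set \<Rightarrow> pt \<Rightarrow> bool" where
  "anchor C a \<longleftrightarrow> a \<notin> C \<and> (\<exists>F. (\<forall>P\<in>F. a_line a P) \<and> C = \<Union>F)"

definition hyperplane :: "pt set \<Rightarrow> bool" where
  "hyperplane H \<longleftrightarrow> (\<exists>v::pt. \<exists>c::3. v \<noteq> 0 \<and> H = {x. (\<Sum>i\<in>UNIV. v $ i * x $ i) = c})"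

definition cohyperplanar :: "pt set \<Rightarrow> bool" where
  "cohyperplanar S \<longleftrightarrow> (\<exists>H. hyperplane H \<and> S \<subseteq> H)"

definition demicap_anchor :: "pt set \<Rightarrow> pt \<Rightarrow> bool" where
  "demicap_anchor E a \<longleftrightarrow> is_cap E \<and> card E = 10 \<and>
     (\<exists>F. card F = 5 \<and> (\<forall>P\<in>F. a_line a P) \<and> E = \<Union>F \<and>
        (\<forall>G\<subseteq>F. card G = 4 \<longrightarrow> \<not> cohyperplanar (\<Union>G)))"

definition demicap :: "pt set \<Rightarrow> bool" where
  "demicap E \<longleftrightarrow> (\<exists>a. demicap_anchor E a)"

definition completes :: "pt set \<Rightarrow> pt \<Rightarrow> nat" where
  "completes S p = card {{x, y} | x y. x \<in> S \<and> y \<in> S \<and> x \<noteq> y \<and> is_line {p, x, y}}"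

text \<open>Phi({E,E'}) for a maximal cap K = E \<union> E' (E, E' disjoint demicaps) with anchor a.\<close>
definition Phi :: "pt set \<Rightarrow> pt set \<Rightarrow> pt set" where
  "Phi E E' = {p. p \<notin> E \<union> E' \<and> (\<forall>a. anchor (E \<union> E') a \<longrightarrow> p \<noteq> a) \<and>
                  completes E p = 1 \<and> completes E' p = 1}"

definition cap_partition :: "pt \<Rightarrow> pt set set \<Rightarrow> bool" where
  "cap_partition a Q \<longleftrightarrow> card Q = 4 \<and> (\<forall>K\<in>Q. max_cap K \<and> anchor K a) \<and>
     disjoint Q \<and> a \<notin> \<Union>Q \<and> insert a (\<Union>Q) = UNIV"

definition completable :: "nat \<Rightarrow> pt set \<Rightarrow> pt set \<Rightarrow> bool" where
  "completable k C K \<longleftrightarrow> max_cap C \<and> max_cap K \<and> C \<inter> K = {} \<and>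
     card {Q. (\<exists>a. cap_partition a Q) \<and> C \<in> Q \<and> K \<in> Q} = k"

end

theory Submission
  imports Defs
begin

text \<open>
  A demicap with anchor a is a \<plusminus> v1, ..., a \<plusminus> v5 where v1, ..., v4 is a basis and, after
  changing signs, v5 = v1 + v2 + v3 + v4. Up to an affine bijection there is thus only one demicap.
  An exhaustive search finds the six caps of size 20 containing it; for each of them the set
  \<open>Phi\<close> is the same explicit cap C, and the products R \<union> D are 36 explicit caps.

  Two point reflections compose to a translation, so a cap has at most one anchor and every
  partition containing C consists of caps symmetric about a. Such caps of size 20 are the ten-point
  caps (elliptic quadrics) of the projective space of lines through a. A second search finds the
  198 of them which are disjoint from C: a product has exactly two disjoint mates, and these
  are disjoint from each other; every other one can be completed in at least two ways.
\<close>

text \<open>A partition containing C and K has the form {C, K, L, M}. Conversely, pairwise disjoint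
  L and M of the right kind fill the rest automatically, because 4 * 20 + 1 = 81. So the number of
  partitions is the number of disjoint pairs among the symmetric caps that avoid both C and K, a
  question about disjointness alone. Passing from 20 vectors to 10 points of PG(3,3) shrinks the
  search, and removing C leaves 30 of the 40 projective points. The obstacle is that C1 and R1 each
  have a normal form, but in unrelated coordinates. Explicit sets are therefore written only in the
  coordinates of C1, where R1 becomes one of six sets R. The caps through R1 are then identified by
  counting: the normal form of R1 shows that there are six of them, and six are already known,
  namely the products with this R. The number 20 is read off from C', a maximal cap made of two
  disjoint ten-point sets.\<close>

section \<open>Lines, caps and anchors in terms of point reflections\<close>

lemma F3_triple: "(k::3) + k + k = 0"
  using exhaust_3[of k] by auto

lemma pt_triple [simp]: "(x::pt) + x + x = 0"
  by (simp only: vec_eq_iff vector_add_component zero_index F3_triple simp_thms)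

lemma pt_double: "(x::pt) + x = - x"
  using pt_triple[of x] by (simp add: eq_neg_iff_add_eq_0)

lemma is_line_iff_sum: "is_line L \<longleftrightarrow> card L = 3 \<and> \<Sum>L = 0"
proof
  assume "is_line L"
  then show "card L = 3 \<and> \<Sum>L = 0"
    unfolding is_line_def by (auto simp: add.assoc)
next
  assume L: "card L = 3 \<and> \<Sum>L = 0"
  then obtain x y z where "L = {x, y, z}" "x \<noteq> y" "y \<noteq> z" "x \<noteq> z"
    by (auto simp: card_3_iff)
  with L show "is_line L"
    unfolding is_line_def by (intro exI[of _ x] exI[of _ y] exI[of _ z]) (simp add: add.assoc)
qed

text \<open>In characteristic 3, - p - x is the image of x under the point reflection in p, since -
  p = p + p. Anchors, completed lines and third points are all handled through this map.\<close>

lemma reflect_eq_iff: "- p - x = x \<longleftrightarrow> x = (p::pt)" "- p - x = p \<longleftrightarrow> x = (p::pt)"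
proof -
  show "- p - x = x \<longleftrightarrow> x = p" by (auto simp: diff_eq_eq pt_double)
  have "- p - x = p \<longleftrightarrow> p + p = p + x"
    by (auto simp: diff_eq_eq pt_double)
  then show "- p - x = p \<longleftrightarrow> x = p" by auto
qed

lemma is_line_iff: "is_line {x, y, - x - y} \<longleftrightarrow> x \<noteq> y"
proof
  assume "is_line {x, y, - x - y}"
  then show "x \<noteq> y"
    unfolding is_line_iff_sum by (auto simp: card_insert_if split: if_splits)
next
  assume "x \<noteq> y"
  moreover have "y \<noteq> - x - y" "x \<noteq> - x - y"
    using calculation reflect_eq_iff[of x y] by auto
  ultimately show "is_line {x, y, - x - y}"
    unfolding is_line_def by (intro exI[of _ x] exI[of _ y] exI[of _ "- x - y"]) auto
qed

lemma is_lineD: "is_line {a, b, c} \<Longrightarrow> a \<noteq> b \<and> c = - a - b"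
proof -
  assume l: "is_line {a, b, c}"
  then have "card {a, b, c} = 3" by (simp add: is_line_iff_sum)
  then have d: "a \<noteq> b" "a \<noteq> c" "b \<noteq> c"
    by (auto simp: card_insert_if split: if_splits)
  with l have "a + (b + c) = 0" by (simp add: is_line_iff_sum)
  then have "c = - a - b" by (simp add: eq_diff_eq eq_neg_iff_add_eq_0 ac_simps)
  with d show ?thesis by blast
qed

lemma is_cap_iff: "is_cap C \<longleftrightarrow> (\<forall>x\<in>C. \<forall>y\<in>C. x \<noteq> y \<longrightarrow> - x - y \<notin> C)"
proof
  assume "is_cap C"
  then show "\<forall>x\<in>C. \<forall>y\<in>C. x \<noteq> y \<longrightarrow> - x - y \<notin> C"
    unfolding is_cap_def using is_line_iff by fastforce
next
  assume r: "\<forall>x\<in>C. \<forall>y\<in>C. x \<noteq> y \<longrightarrow> - x - y \<notin> C"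
  show "is_cap C"
    unfolding is_cap_def
  proof (intro allI impI notI)
    fix L assume "is_line L" "L \<subseteq> C"
    then obtain x y z where L: "L = {x, y, z}" by (auto simp: is_line_def)
    with \<open>is_line L\<close> have "x \<noteq> y" "z = - x - y" using is_lineD by blast+
    with r L \<open>L \<subseteq> C\<close> show False by auto
  qed
qed

lemma a_line_iff: "a_line a P \<longleftrightarrow> (\<exists>x. x \<noteq> a \<and> P = {x, - a - x})"
  proof
  assume "a_line a P"
  then obtain b c where "P = {b, c}" "is_line {a, b, c}" by (auto simp: a_line_def)
  with is_lineD[of a b c] show "\<exists>x. x \<noteq> a \<and> P = {x, - a - x}" by (intro exI[of _ b]) auto
next
  assume "\<exists>x. x \<noteq> a \<and> P = {x, - a - x}"
  then obtain x where "x \<noteq> a" "P = {x, - a - x}" by blast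
  with is_line_iff[of a x] show "a_line a P" unfolding a_line_def by blast
qed

text \<open>The a-lines are the two-point orbits of the reflection in a, so their unions are the
  invariant sets avoiding a.\<close>

lemma anchor_iff: "anchor C a \<longleftrightarrow> a \<notin> C \<and> (\<forall>x\<in>C. - a - x \<in> C)"
proof
  assume "anchor C a"
  then show "a \<notin> C \<and> (\<forall>x\<in>C. - a - x \<in> C)"
    unfolding anchor_def a_line_iff by fastforce
next
  assume r: "a \<notin> C \<and> (\<forall>x\<in>C. - a - x \<in> C)"
  show "anchor C a"
    unfolding anchor_def
  proof (intro conjI exI[of _ "(\<lambda>x. {x, - a - x}) ` C"] ballI)
    fix P assume "P \<in> (\<lambda>x. {x, - a - x}) ` C"
    with r show "a_line a P" unfolding a_line_iff by auto
  qed (use r in auto)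
qed

lemma anchor_unique:
  assumes "is_cap C" "C \<noteq> {}" "anchor C a" "anchor C b"
  shows "a = b"
proof (rule ccontr)
  assume "a \<noteq> b"
  obtain x where x: "x \<in> C" using assms by blast
  define t where "t = a - b"
  have tr: "y + t \<in> C" if "y \<in> C" for y
  proof -
    have "- b - (- a - y) \<in> C" using that assms(3,4) by (simp add: anchor_iff)
    then show ?thesis by (simp add: t_def algebra_simps)
  qed
  \<comment> \<open>Three successive translates by a nonzero t sum to 0 and so form a line inside
    C.\<close>
  have "x + t \<in> C" "x + t + t \<in> C" using tr x by blast+
  moreover have "- x - (x + t) = x + t + t"
    using pt_double[of x] pt_double[of t]
    by (simp add: diff_diff_eq [symmetric] add.assoc)
  moreover have "x \<noteq> x + t" using \<open>a \<noteq> b\<close> by (simp add: t_def)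
  ultimately show False using assms(1) x unfolding is_cap_iff by metis
qed

text \<open>Trades counting unordered pairs for counting points, which evaluation on lists can do. A
  fixed-point-free self-map of a two-element set swaps its points.\<close>

lemma card_orbits_eq_1_iff:
  assumes "\<And>x. x \<in> N \<Longrightarrow> t x \<in> N" "\<And>x. x \<in> N \<Longrightarrow> t x \<noteq> x"
  shows "card ((\<lambda>x. {x, t x}) ` N) = 1 \<longleftrightarrow> card N = 2"
proof
  assume "card ((\<lambda>x. {x, t x}) ` N) = 1"
  then obtain P where P: "(\<lambda>x. {x, t x}) ` N = {P}" by (auto simp: card_1_singleton_iff)
  then obtain x where x: "x \<in> N" "P = {x, t x}" by blast
  have "y \<in> {x, t x}" if "y \<in> N" for y
  proof -
    have "{y, t y} \<in> {P}" unfolding P[symmetric] using that by (rule imageI)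
    then have "y \<in> P" by blast
    then show ?thesis unfolding x(2) .
  qed
  then have "N = {x, t x}" using x(1) assms(1)[OF x(1)] by auto
  then show "card N = 2" using assms(2)[OF x(1)] by (metis card_2_iff)
next
  assume c: "card N = 2"
  then obtain x where x: "x \<in> N" by (metis card.empty ex_in_conv zero_neq_numeral)
  have "{x, t x} = N"
    using x assms(1)[OF x] assms(2)[OF x] c
    by (intro card_subset_eq) (auto intro: card_ge_0_finite)
  moreover have "t (t x) = x"
    using assms(1)[of "t x"] assms(2)[of "t x"] calculation by auto
  ultimately have "(\<lambda>x. {x, t x}) ` N = {{x, t x}}" by auto
  then show "card ((\<lambda>x. {x, t x}) ` N) = 1" by simp
qed

text \<open>The completed lines are the orbits of the reflection in p on those points of S whose
  image stays in S. Its fixed point p has to be removed, as S may contain it.\<close>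

lemma completes_eq_1_iff:
  "completes S p = 1 \<longleftrightarrow> card {x \<in> S. - p - x \<in> S \<and> x \<noteq> p} = 2"
proof -
  let ?N = "{x \<in> S. - p - x \<in> S \<and> x \<noteq> p}"
  let ?t = "\<lambda>x. - p - x"
  have fp: "?t x = x \<longleftrightarrow> x = p" "?t x = p \<longleftrightarrow> x = p" for x
    using reflect_eq_iff by auto
  have eq: "{{x, y} | x y. x \<in> S \<and> y \<in> S \<and> x \<noteq> y \<and> is_line {p, x, y}} = (\<lambda>x. {x, ?t x}) ` ?N"
  proof (intro equalityI subsetI)
    fix P assume "P \<in> {{x, y} | x y. x \<in> S \<and> y \<in> S \<and> x \<noteq> y \<and> is_line {p, x, y}}"
    then obtain x y where P: "P = {x, y}" "x \<in> S" "y \<in> S" "is_line {p, x, y}" by blast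
    from is_lineD[OF P(4)] P show "P \<in> (\<lambda>x. {x, ?t x}) ` ?N" by auto
  next
    fix P assume "P \<in> (\<lambda>x. {x, ?t x}) ` ?N"
    then obtain x where x: "P = {x, ?t x}" "x \<in> S" "?t x \<in> S" "x \<noteq> p" by blast
    moreover have "is_line {p, x, ?t x}" using is_line_iff[of p x] x by auto
    moreover have "x \<noteq> ?t x" using fp(1)[of x] x by auto
    ultimately show "P \<in> {{x, y} | x y. x \<in> S \<and> y \<in> S \<and> x \<noteq> y \<and> is_line {p, x, y}}" by blast
  qed
  have tt: "?t (?t x) = x" for x by simp
  have tN: "?t x \<in> ?N" if "x \<in> ?N" for x
    using that fp by simp
  show ?thesis
    unfolding completes_def eq using tN fp(1) by (intro card_orbits_eq_1_iff) auto
qed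

section \<open>Coordinates\<close>

text \<open>
  The searches are evaluated by rewriting. Branching by pattern matching on Boolean arguments
  instead of \<open>if\<close> spares the simplifier the repeated traversal of normalized arguments.
\<close>

datatype trit = TZ | TP | TN

fun trit_eq :: "trit \<Rightarrow> trit \<Rightarrow> bool" where
  "trit_eq TZ TZ = True" | "trit_eq TP TP = True" | "trit_eq TN TN = True"
| "trit_eq _ _ = False"

fun trit_neg :: "trit \<Rightarrow> trit" where
  "trit_neg TZ = TZ" | "trit_neg TP = TN" | "trit_neg TN = TP"

fun trit_add :: "trit \<Rightarrow> trit \<Rightarrow> trit" where
  "trit_add TZ y = y" | "trit_add TP TZ = TP" | "trit_add TP TP = TN" | "trit_add TP TN = TZ"
| "trit_add TN TZ = TN" | "trit_add TN TP = TZ" | "trit_add TN TN = TP"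

datatype tvec = TV trit trit trit trit

fun and_trit_eq :: "bool \<Rightarrow> trit \<Rightarrow> trit \<Rightarrow> bool" where
  "and_trit_eq False a b = False"
| "and_trit_eq True a b = trit_eq a b"

fun tv_eq :: "tvec \<Rightarrow> tvec \<Rightarrow> bool" where
  "tv_eq (TV a b c d) (TV a' b' c' d') =
     and_trit_eq (and_trit_eq (and_trit_eq (trit_eq a a') b b') c c') d d'"

fun tv_neg :: "tvec \<Rightarrow> tvec" where
  "tv_neg (TV a b c d) = TV (trit_neg a) (trit_neg b) (trit_neg c) (trit_neg d)"

fun tv_add :: "tvec \<Rightarrow> tvec \<Rightarrow> tvec" where
  "tv_add (TV a b c d) (TV a' b' c' d') =
     TV (trit_add a a') (trit_add b b') (trit_add c c') (trit_add d d')"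

definition origin :: tvec where "origin = TV TZ TZ TZ TZ"

definition third :: "tvec \<Rightarrow> tvec \<Rightarrow> tvec" where
  "third x y = tv_neg (tv_add x y)"

text \<open>Selects one vector from each pair x, - x of nonzero vectors. The origin is excluded, so
  normed vectors correspond to the 40 points of PG(3,3).\<close>

fun normed :: "tvec \<Rightarrow> bool" where
  "normed (TV TP b c d) = True" | "normed (TV TN b c d) = False"
| "normed (TV TZ TP c d) = True" | "normed (TV TZ TN c d) = False"
| "normed (TV TZ TZ TP d) = True" | "normed (TV TZ TZ TN d) = False"
| "normed (TV TZ TZ TZ TP) = True" | "normed (TV TZ TZ TZ TN) = False"
| "normed (TV TZ TZ TZ TZ) = False"

definition tv_norm :: "tvec \<Rightarrow> tvec" where
  "tv_norm x = (if normed x then x else tv_neg x)"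

fun mem :: "tvec \<Rightarrow> tvec list \<Rightarrow> bool"
  and or_mem :: "bool \<Rightarrow> tvec \<Rightarrow> tvec list \<Rightarrow> bool" where
  "mem x [] = False"
| "mem x (y # ys) = or_mem (tv_eq x y) x ys"
| "or_mem True x ys = True"
| "or_mem False x ys = mem x ys"

definition all_vecs :: "tvec list" where
  "all_vecs = (let ts = [TZ, TP, TN] in
     concat (map (\<lambda>a. concat (map (\<lambda>b. concat (map (\<lambda>c. map (TV a b c) ts) ts)) ts)) ts))"

lemma trit_eq_iff [simp]: "trit_eq a b \<longleftrightarrow> a = b"
  by (cases a; cases b) auto

lemma and_trit_eq_iff [simp]: "and_trit_eq P a b \<longleftrightarrow> P \<and> a = b"
  by (cases P) auto

lemma tv_eq_iff [simp]: "tv_eq x y \<longleftrightarrow> x = y"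
  by (cases x; cases y) auto

lemma mem_iff [simp]: "mem x ys \<longleftrightarrow> x \<in> set ys"
  and or_mem_iff [simp]: "or_mem P x ys \<longleftrightarrow> P \<or> x \<in> set ys"
proof (induction x ys and P x ys rule: mem_or_mem.induct) qed auto

lemma trit_neg_neg [simp]: "trit_neg (trit_neg a) = a"
  by (cases a) auto

lemma trit_neg_add [simp]: "trit_neg (trit_add a b) = trit_add (trit_neg a) (trit_neg b)"
  by (cases a; cases b) auto

lemma trit_add_commute: "trit_add a b = trit_add b a"
  by (cases a; cases b) auto

lemma trit_add_neg [simp]: "trit_add a (trit_neg a) = TZ" "trit_add (trit_neg a) a = TZ"
  by (cases a; simp)+

lemma trit_add_neg_eq_TZ: "trit_add a (trit_neg b) = TZ \<longleftrightarrow> a = b"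
  by (cases a; cases b) auto

lemma tv_neg_neg [simp]: "tv_neg (tv_neg x) = x"
  by (cases x) auto

lemma tv_neg_add: "tv_neg (tv_add x y) = tv_add (tv_neg x) (tv_neg y)"
  by (cases x; cases y) auto

lemma tv_add_commute: "tv_add x y = tv_add y x"
  by (cases x; cases y) (auto simp: trit_add_commute)

lemma tv_add_neg [simp]: "tv_add x (tv_neg x) = origin" "tv_add (tv_neg x) x = origin"
  by (cases x; simp add: origin_def)+

lemma tv_add_neg_eq_origin: "tv_add x (tv_neg y) = origin \<longleftrightarrow> x = y"
  by (cases x; cases y) (auto simp: origin_def trit_add_neg_eq_TZ)

lemma tv_neg_origin [simp]: "tv_neg origin = origin"
  by (simp add: origin_def)

lemma third_origin: "third origin x = tv_neg x"
  by (cases x) (simp add: third_def origin_def)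

lemma third_commute: "third x y = third y x"
  by (simp add: third_def tv_add_commute)

lemma not_normed_origin [simp]: "\<not> normed origin"
  by (simp add: origin_def)

lemma normed_neg: "x \<noteq> origin \<Longrightarrow> normed (tv_neg x) \<longleftrightarrow> \<not> normed x"
  by (cases x rule: normed.cases) (auto simp: origin_def)

lemma tv_norm_neg [simp]: "tv_norm (tv_neg x) = tv_norm x"
  using normed_neg[of x] by (cases "x = origin") (auto simp: tv_norm_def)

lemma tv_norm_normed: "normed x \<Longrightarrow> tv_norm x = x"
  by (simp add: tv_norm_def)

lemma tv_norm_cases: "tv_norm x = x \<or> tv_norm x = tv_neg x"
  by (simp add: tv_norm_def)

lemma set_all_vecs [simp]: "set all_vecs = UNIV"
proof -
  have "TV a b c d \<in> set all_vecs" for a b c d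
    by (cases a; cases b; cases c; cases d) (simp_all add: all_vecs_def)
  then show ?thesis by (metis UNIV_eq_I tvec.exhaust)
qed

lemma card_tvec: "card (UNIV :: tvec set) = 81"
proof -
  have "distinct all_vecs" "length all_vecs = 81" by code_simp+
  then show ?thesis using distinct_card[of all_vecs] by simp
qed

lemma finite_tvec [simp]: "finite (X :: tvec set)"
  by (rule finite_subset[OF subset_UNIV]) (simp add: card_ge_0_finite card_tvec)

section \<open>Frames\<close>

fun trit_scale :: "trit \<Rightarrow> pt \<Rightarrow> pt" where
  "trit_scale TZ v = 0" | "trit_scale TP v = v" | "trit_scale TN v = - v"

fun lin :: "pt \<Rightarrow> pt \<Rightarrow> pt \<Rightarrow> pt \<Rightarrow> tvec \<Rightarrow> pt" where
  "lin v1 v2 v3 v4 (TV a b c d) =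
     trit_scale a v1 + trit_scale b v2 + trit_scale c v3 + trit_scale d v4"

definition dot :: "pt \<Rightarrow> pt \<Rightarrow> 3" where
  "dot w x = (\<Sum>i\<in>UNIV. w $ i * x $ i)"

text \<open>Linear independence in dual form: only the zero functional kills all four vectors.
  Hyperplanes are given by normal vectors, so this is what the failure of four a-lines to be
  co-hyperplanar yields directly.\<close>

definition indep :: "pt \<Rightarrow> pt \<Rightarrow> pt \<Rightarrow> pt \<Rightarrow> bool" where
  "indep v1 v2 v3 v4 \<longleftrightarrow>
     (\<forall>w. dot w v1 = 0 \<and> dot w v2 = 0 \<and> dot w v3 = 0 \<and> dot w v4 = 0 \<longrightarrow> w = 0)"

lemma dot_simps [simp]:
  "dot w 0 = 0" "dot w (x + y) = dot w x + dot w y" "dot w (- x) = - dot w x"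
  "dot w (x - y) = dot w x - dot w y" "dot (w - w') x = dot w x - dot w' x"
  by (simp_all add: dot_def sum.distrib sum_negf sum_subtractf algebra_simps)

lemma trit_scale_neg [simp]: "trit_scale (trit_neg a) v = - trit_scale a v"
  by (cases a) auto

lemma trit_scale_add: "trit_scale (trit_add a b) v = trit_scale a v + trit_scale b v"
  by (cases a; cases b) (simp_all add: pt_double pt_double[of "- v", simplified])

lemma lin_neg: "lin v1 v2 v3 v4 (tv_neg x) = - lin v1 v2 v3 v4 x"
  by (cases x) simp

lemma lin_add: "lin v1 v2 v3 v4 (tv_add x y) = lin v1 v2 v3 v4 x + lin v1 v2 v3 v4 y"
  by (cases x; cases y) (simp add: trit_scale_add ac_simps)

lemma card_pt: "card (UNIV :: pt set) = 81"
  by (simp add: CARD_vec)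

text \<open>Independence makes the map from w to its four values injective, and both sides have 81
  elements. Counting thus supplies the dual basis.\<close>

lemma dot_surj:
  assumes "indep v1 v2 v3 v4"
  obtains w where "dot w v1 = k1" "dot w v2 = k2" "dot w v3 = k3" "dot w v4 = k4"
proof -
  let ?d = "\<lambda>w. (dot w v1, dot w v2, dot w v3, dot w v4)"
  have "inj ?d"
  proof (rule injI)
    fix w w' assume "?d w = ?d w'"
    then have "dot (w - w') v1 = 0 \<and> dot (w - w') v2 = 0 \<and> dot (w - w') v3 = 0 \<and> dot (w - w') v4 = 0"
      by simp
    then have "w - w' = 0" using assms unfolding indep_def by blast
    then show "w = w'" by simp
  qed
  then have "card (range ?d) = card (UNIV :: pt set)" by (rule card_image)
  also have "\<dots> = card (UNIV :: (3 \<times> 3 \<times> 3 \<times> 3) set)"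
    unfolding card_pt by (simp add: UNIV_Times_UNIV[symmetric] card_cartesian_product del: UNIV_Times_UNIV)
  finally have "range ?d = UNIV" by (intro card_subset_eq) auto
  then have "(k1, k2, k3, k4) \<in> range ?d" by blast
  then show thesis using that by auto
qed

lemma dot_trit_scale_eq_0: "dot w v = 1 \<Longrightarrow> dot w (trit_scale a v) = 0 \<Longrightarrow> a = TZ"
  by (cases a) auto

lemma dot_trit_scale_0: "dot w v = 0 \<Longrightarrow> dot w (trit_scale a v) = 0"
  by (cases a) auto

text \<open>Each member of the dual basis reads off one coefficient.\<close>

lemma lin_eq_0:
  assumes ind: "indep v1 v2 v3 v4" and 0: "lin v1 v2 v3 v4 x = 0"
  shows "x = origin"
proof (cases x)
  case (TV a b c d)
  with 0 have s: "dot w (trit_scale a v1) + dot w (trit_scale b v2) + dot w (trit_scale c v3)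
      + dot w (trit_scale d v4) = 0" for w
    by (metis dot_simps(1,2) lin.simps)
  obtain w where "dot w v1 = 1" "dot w v2 = 0" "dot w v3 = 0" "dot w v4 = 0"
    using dot_surj[OF ind] .
  then have a: "a = TZ" using s[of w] dot_trit_scale_eq_0[of w v1 a] by (simp add: dot_trit_scale_0)
  obtain w where "dot w v1 = 0" "dot w v2 = 1" "dot w v3 = 0" "dot w v4 = 0"
    using dot_surj[OF ind] .
  then have b: "b = TZ" using s[of w] dot_trit_scale_eq_0[of w v2 b] by (simp add: dot_trit_scale_0)
  obtain w where "dot w v1 = 0" "dot w v2 = 0" "dot w v3 = 1" "dot w v4 = 0"
    using dot_surj[OF ind] .
  then have c: "c = TZ" using s[of w] dot_trit_scale_eq_0[of w v3 c] by (simp add: dot_trit_scale_0)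
  obtain w where "dot w v1 = 0" "dot w v2 = 0" "dot w v3 = 0" "dot w v4 = 1"
    using dot_surj[OF ind] .
  then have d: "d = TZ" using s[of w] dot_trit_scale_eq_0[of w v4 d] by (simp add: dot_trit_scale_0)
  show ?thesis using TV a b c d by (simp add: origin_def)
qed

lemma bij_lin:
  assumes "indep v1 v2 v3 v4"
  shows "bij (lin v1 v2 v3 v4)"
proof -
  have inj: "inj (lin v1 v2 v3 v4)"
  proof (rule injI)
    fix x y assume "lin v1 v2 v3 v4 x = lin v1 v2 v3 v4 y"
    then have "lin v1 v2 v3 v4 (tv_add x (tv_neg y)) = 0" by (simp add: lin_add lin_neg)
    from lin_eq_0[OF assms this] show "x = y" by (simp add: tv_add_neg_eq_origin)
  qed
  then have "card (range (lin v1 v2 v3 v4)) = card (UNIV :: pt set)"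
    by (simp add: card_image card_tvec card_pt)
  then have "range (lin v1 v2 v3 v4) = UNIV" by (intro card_subset_eq) auto
  with inj show ?thesis by (simp add: bij_def)
qed

text \<open>Affine coordinates, recorded only through what the geometry of lines sees: a bijection
  compatible with third points. Caps, anchors centred at \<open>\<phi> origin\<close> and completed
  lines can all be transported along it.\<close>

locale frame =
  fixes \<phi> :: "tvec \<Rightarrow> pt"
  assumes bij: "bij \<phi>"
    and third: "\<phi> (third x y) = - \<phi> x - \<phi> y"

lemma frame_lin:
  assumes "indep v1 v2 v3 v4"
  shows "frame (\<lambda>x. a + lin v1 v2 v3 v4 x)"
proof
  have "bij ((+) a \<circ> lin v1 v2 v3 v4)"
    using bij_lin[OF assms] by (intro bij_comp) (simp_all add: bij_def)
  then show "bij (\<lambda>x. a + lin v1 v2 v3 v4 x)" by (simp add: comp_def)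
  show "a + lin v1 v2 v3 v4 (third x y) = - (a + lin v1 v2 v3 v4 x) - (a + lin v1 v2 v3 v4 y)"
    for x y
    using pt_double[of a]
    by (simp add: third_def lin_neg lin_add algebra_simps)
qed

definition demicap0 :: "tvec list" where
  "demicap0 = [TV TP TZ TZ TZ, TV TZ TP TZ TZ, TV TZ TZ TP TZ, TV TZ TZ TZ TP, TV TP TP TP TP,
         TV TN TZ TZ TZ, TV TZ TN TZ TZ, TV TZ TZ TN TZ, TV TZ TZ TZ TN, TV TN TN TN TN]"

lemma indep_if_not_cohyperplanar:
  assumes "\<not> cohyperplanar ({a + v1, a - v1} \<union> {a + v2, a - v2} \<union> {a + v3, a - v3} \<union> {a + v4, a - v4})"
  shows "indep v1 v2 v3 v4"
  unfolding indep_def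
proof (intro allI impI, rule ccontr)
  fix w assume 0: "dot w v1 = 0 \<and> dot w v2 = 0 \<and> dot w v3 = 0 \<and> dot w v4 = 0" and "w \<noteq> 0"
  then have "hyperplane {x. dot w x = dot w a}"
    unfolding hyperplane_def dot_def by blast
  moreover have "{a + v1, a - v1} \<union> {a + v2, a - v2} \<union> {a + v3, a - v3} \<union> {a + v4, a - v4}
      \<subseteq> {x. dot w x = dot w a}" using 0 by simp
  ultimately show False using assms unfolding cohyperplanar_def by blast
qed

lemma demicap_frame:
  assumes "demicap E"
  obtains \<phi> where "frame \<phi>" "E = \<phi> ` set demicap0"
proof -
  obtain a F where F: "card F = 5" "\<forall>P\<in>F. a_line a P" "E = \<Union>F"
    and nc: "\<And>G. G \<subseteq> F \<Longrightarrow> card G = 4 \<Longrightarrow> \<not> cohyperplanar (\<Union>G)"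
    using assms unfolding demicap_def demicap_anchor_def by blast
  have ex: "\<exists>v. P = {a + v, a - v}" if "P \<in> F" for P
  proof -
    obtain x where "P = {x, - a - x}" using F(2) \<open>P \<in> F\<close> by (auto simp: a_line_iff)
    then have "P = {a + (x - a), a - (x - a)}" by (simp add: diff_diff_eq2 pt_double)
    then show ?thesis by blast
  qed
  obtain P1 P2 P3 P4 P5 where P: "F = {P1, P2, P3, P4, P5}" and d: "distinct [P1, P2, P3, P4, P5]"
  proof -
    have "finite F" using F(1) by (simp add: card_ge_0_finite)
    then obtain Ps where "set Ps = F" "distinct Ps" using finite_distinct_list by blast
    moreover from this F(1) have "length Ps = Suc (Suc (Suc (Suc (Suc 0))))"
      using distinct_card[of Ps] by simp
    ultimately show thesis using that by (auto simp: length_Suc_conv)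
  qed
  obtain v1 v2 v3 v4 v5 where v: "P1 = {a + v1, a - v1}" "P2 = {a + v2, a - v2}"
    "P3 = {a + v3, a - v3}" "P4 = {a + v4, a - v4}" "P5 = {a + v5, a - v5}"
    using ex[of P1] ex[of P2] ex[of P3] ex[of P4] ex[of P5] unfolding P by auto
  have nc': "\<not> cohyperplanar (A \<union> B \<union> C \<union> D)"
    if "{A, B, C, D} \<subseteq> F" "distinct [A, B, C, D]" for A B C D
    using nc[OF that(1)] that(2) by (simp add: Un_assoc)
  have ind: "indep u1 u2 u3 u4"
    if "{{a + u1, a - u1}, {a + u2, a - u2}, {a + u3, a - u3}, {a + u4, a - u4}} \<subseteq> F"
      "distinct [{a + u1, a - u1}, {a + u2, a - u2}, {a + u3, a - u3}, {a + u4, a - u4}]"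
    for u1 u2 u3 u4
    using nc'[OF that] by (rule indep_if_not_cohyperplanar)
  \<comment> \<open>In the last four quadruples v5 takes the slot of v4, v3, v2, v1
    respectively.\<close>
  have i: "indep v1 v2 v3 v4" "indep v1 v2 v3 v5" "indep v1 v2 v5 v4" "indep v1 v5 v3 v4" "indep v5 v2 v3 v4"
    by (rule ind; fold v; use d in \<open>auto simp: P\<close>)+
  obtain c1 c2 c3 c4 where v5: "v5 = lin v1 v2 v3 v4 (TV c1 c2 c3 c4)"
    by (metis bij_lin[OF i(1)] bij_pointE tvec.exhaust)
  \<comment> \<open>If c1 were TZ, the coefficients TN, c2, c3, c4 would give a nontrivial relation
    between v5, v2, v3, v4. The other cases put TN in the slot taken by v5.\<close>
  have "c1 \<noteq> TZ"
    using lin_eq_0[OF i(5), of "TV TN c2 c3 c4"] v5 by (auto simp: origin_def)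
  moreover have "c2 \<noteq> TZ"
    using lin_eq_0[OF i(4), of "TV c1 TN c3 c4"] v5 by (auto simp: origin_def)
  moreover have "c3 \<noteq> TZ"
    using lin_eq_0[OF i(3), of "TV c1 c2 TN c4"] v5 by (auto simp: origin_def)
  moreover have "c4 \<noteq> TZ"
    using lin_eq_0[OF i(2), of "TV c1 c2 c3 TN"] v5 by (auto simp: origin_def)
  ultimately have nz: "c1 \<noteq> TZ" "c2 \<noteq> TZ" "c3 \<noteq> TZ" "c4 \<noteq> TZ" by auto
  define u1 u2 u3 u4 where u: "u1 = trit_scale c1 v1" "u2 = trit_scale c2 v2"
    "u3 = trit_scale c3 v3" "u4 = trit_scale c4 v4"
  have dz: "dot w (trit_scale c v) = 0 \<longleftrightarrow> dot w v = 0" if "c \<noteq> TZ" for c w v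
    using that by (cases c) auto
  have iu: "indep u1 u2 u3 u4"
    using i(1) nz unfolding indep_def u by (simp add: dz)
  \<comment> \<open>A sign change swaps the two points of an a-line, so the signs can be absorbed
    into the basis.\<close>
  have pm: "{a + trit_scale c v, a - trit_scale c v} = {a + v, a - v}" if "c \<noteq> TZ" for c v
    using that by (cases c) auto
  have v5': "v5 = u1 + u2 + u3 + u4" using v5 by (simp add: u)
  have "E = P1 \<union> P2 \<union> P3 \<union> P4 \<union> P5" using F(3) P by auto
  also have "\<dots> = {a + u1, a - u1} \<union> {a + u2, a - u2} \<union> {a + u3, a - u3} \<union> {a + u4, a - u4} \<union> {a + v5, a - v5}"
    unfolding v u pm[OF nz(1)] pm[OF nz(2)] pm[OF nz(3)] pm[OF nz(4)] ..
  also have "\<dots> = (\<lambda>x. a + lin u1 u2 u3 u4 x) ` set demicap0"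
    unfolding v5' demicap0_def by (auto simp: algebra_simps)
  finally show thesis using that[OF frame_lin[OF iu]] by blast
qed

section \<open>Exhaustive search for caps\<close>

text \<open>\<open>bad x y\<close> lists the points forbidden once x and y are chosen: the third
  point of an affine line, or the other two of a projective line over F_3. The parameter lets one
  search serve both geometries.\<close>

definition conflict_free :: "(tvec \<Rightarrow> tvec \<Rightarrow> tvec list) \<Rightarrow> tvec set \<Rightarrow> bool" where
  "conflict_free bad S \<longleftrightarrow> (\<forall>x\<in>S. \<forall>y\<in>S. x \<noteq> y \<longrightarrow> S \<inter> set (bad x y) = {})"

fun cons_unless :: "bool \<Rightarrow> 'a \<Rightarrow> 'a list \<Rightarrow> 'a list" where
  "cons_unless True x xs = xs"
| "cons_unless False x xs = x # xs"

fun cons_nonempty :: "'a list \<Rightarrow> 'a list list \<Rightarrow> 'a list list" where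
  "cons_nonempty [] gs = gs"
| "cons_nonempty (x # xs) gs = (x # xs) # gs"

fun remove :: "tvec list \<Rightarrow> tvec list \<Rightarrow> tvec list" where
  "remove bs [] = []"
| "remove bs (x # xs) = cons_unless (mem x bs) x (remove bs xs)"

text \<open>Emptied groups are dropped because the number of remaining groups serves as the bound on
  how many points can still be chosen.\<close>

fun prune :: "tvec list \<Rightarrow> tvec list list \<Rightarrow> tvec list list" where
  "prune bs [] = []"
| "prune bs (g # gs) = cons_nonempty (remove bs g) (prune bs gs)"

fun bads :: "(tvec \<Rightarrow> tvec \<Rightarrow> tvec list) \<Rightarrow> tvec \<Rightarrow> tvec list \<Rightarrow> tvec list" where
  "bads bad r [] = []"
| "bads bad r (c # cs) = bad c r @ bads bad r cs"

fun longer :: "'a list \<Rightarrow> 'b list \<Rightarrow> bool" where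
  "longer xs [] = True"
| "longer [] (y # ys) = False"
| "longer (x # xs) (y # ys) = longer xs ys"

text \<open>
  The number of points still to be chosen is the length of a unit list. A cap has at most one
  point in each of the remaining groups, which gives the bound for pruning.
\<close>

fun csearch :: "(tvec \<Rightarrow> tvec \<Rightarrow> tvec list) \<Rightarrow> unit list \<Rightarrow> tvec list \<Rightarrow> tvec list list \<Rightarrow> tvec list list"
  where
  "csearch bad [] ch gs = [ch]"
| "csearch bad (u # n) ch [] = []"
| "csearch bad (u # n) ch (g # gs) =
     (if longer gs n then
        concat (map (\<lambda>r. csearch bad n (r # ch) (prune (bads bad r ch) gs)) g)
        @ csearch bad (u # n) ch gs
      else [])"

lemma cons_unless_eq [simp]: "cons_unless b x xs = (if b then xs else x # xs)"
  by (cases b) auto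

lemma set_cons_nonempty: "\<Union>(set ` set (cons_nonempty g gs)) = set g \<union> \<Union>(set ` set gs)"
  by (cases g) auto

lemma in_cons_nonempty: "h \<in> set (cons_nonempty g gs) \<Longrightarrow> h = g \<or> h \<in> set gs"
  by (cases g) auto

lemma set_remove [simp]: "set (remove bs xs) = set xs - set bs"
  by (induction xs) auto

lemma Union_prune: "\<Union>(set ` set (prune bs gs)) = \<Union>(set ` set gs) - set bs"
  by (induction gs) (auto simp: set_cons_nonempty)

lemma in_prune: "h \<in> set (prune bs gs) \<Longrightarrow> \<exists>g\<in>set gs. set h \<subseteq> set g"
  by (induction gs) (auto dest!: in_cons_nonempty)

lemma set_bads [simp]: "set (bads bad r cs) = (\<Union>c\<in>set cs. set (bad c r))"
  by (induction cs) auto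

lemma longer_iff [simp]: "longer xs ys \<longleftrightarrow> length ys \<le> length xs"
  by (induction xs ys rule: longer.induct) auto

text \<open>Each group contributes at most one point of S. The set A is arbitrary so that the
  induction can move the head group into it.\<close>

lemma card_le_number_of_groups:
  fixes S :: "tvec set"
  assumes "S \<subseteq> A \<union> \<Union>(set ` set gs)"
    and "\<And>g x y. g \<in> set gs \<Longrightarrow> x \<in> S \<inter> set g \<Longrightarrow> y \<in> S \<inter> set g \<Longrightarrow> x = y"
  shows "card (S - A) \<le> length gs"
  using assms
proof (induction gs arbitrary: A)
  case Nil
  then show ?case by (simp add: Diff_eq_empty_iff[THEN iffD2])
next
  case (Cons g gs)
  have "card (S - (A \<union> set g)) \<le> length gs"
    using Cons.prems by (intro Cons.IH) auto
  moreover have "card (S \<inter> set g) \<le> 1"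
    using Cons.prems(2)[of g] by (auto simp: card_le_Suc0_iff_eq)
  moreover have "card (S - A) \<le> card ((S - (A \<union> set g)) \<union> (S \<inter> set g))"
    by (intro card_mono) auto
  moreover have "\<dots> \<le> card (S - (A \<union> set g)) + card (S \<inter> set g)"
    by (rule card_Un_le)
  ultimately show ?case by simp
qed

text \<open>Either S has no new point in the first group, which may be skipped, or exactly one, r.
  In the latter case S avoids every point in conflict with r and a chosen point, so pruning loses
  nothing of S. Only completeness is proved here; the results of the searches are checked
  separately.\<close>

lemma csearch_complete:
  assumes "conflict_free bad S"
    and "set ch \<subseteq> S" "card (S - set ch) = length n"
    and "S \<subseteq> set ch \<union> \<Union>(set ` set gs)"
    and "\<And>g x y. g \<in> set gs \<Longrightarrow> x \<in> S \<inter> set g \<Longrightarrow> y \<in> S \<inter> set g \<Longrightarrow> x = y"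
  shows "\<exists>xs\<in>set (csearch bad n ch gs). set xs = S"
  using assms
proof (induction bad n ch gs rule: csearch.induct)
  case (1 bad ch gs)
  then show ?case by auto
next
  case (2 bad u n ch)
  then have "S - set ch = {}" by auto
  then have "card (S - set ch) = 0" by (simp only: card.empty)
  then show ?case using "2.prems"(3) by simp
next
  case (3 bad u n ch g gs)
  \<comment> \<open>Removing one element on both sides gives the guard
    \<open>longer gs n\<close>.\<close>
  have "length (u # n) \<le> length (g # gs)"
    using card_le_number_of_groups[OF "3.prems"(4,5)] "3.prems"(3) by simp
  then have l: "longer gs n" by simp
  show ?case
  proof (cases "S \<inter> set g \<subseteq> set ch")
    case True
    then have "S \<subseteq> set ch \<union> \<Union>(set ` set gs)" using "3.prems"(4) by auto
    with "3.IH"(2)[OF l "3.prems"(1,2,3)] "3.prems"(5)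
    have "\<exists>xs\<in>set (csearch bad (u # n) ch gs). set xs = S" by auto
    then show ?thesis using l by auto
  next
    case False
    then obtain r where r: "r \<in> S" "r \<in> set g" "r \<notin> set ch" by auto
    have g: "S \<inter> set g = {r}" using r "3.prems"(5)[of g] by fastforce
    let ?gs = "prune (bads bad r ch) gs"
    have "S \<inter> set (bads bad r ch) = {}"
      using "3.prems"(1,2) r unfolding conflict_free_def by fastforce
    then have "S \<subseteq> set (r # ch) \<union> \<Union>(set ` set ?gs)"
      using "3.prems"(4) g unfolding Union_prune by auto
    moreover have "S - set (r # ch) = (S - set ch) - {r}" by auto
    then have "card (S - set (r # ch)) = length n"
      using r "3.prems"(3) by simp
    moreover have "x = y" if "h \<in> set ?gs" "x \<in> S \<inter> set h" "y \<in> S \<inter> set h" for h x y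
      using in_prune[OF that(1)] "3.prems"(5) that(2,3) by fastforce
    ultimately have "\<exists>xs\<in>set (csearch bad n (r # ch) ?gs). set xs = S"
      using "3.IH"(1)[OF l r(2)] "3.prems"(1,2) r(1) by auto
    then show ?thesis using l r(2) by auto
  qed
qed

definition aff_bad :: "tvec \<Rightarrow> tvec \<Rightarrow> tvec list" where
  "aff_bad x y = [third x y]"

text \<open>Projective points are represented by vectors whose first nonzero entry is 1.\<close>

definition proj_bad :: "tvec \<Rightarrow> tvec \<Rightarrow> tvec list" where
  "proj_bad x y = [tv_norm (tv_add x y), tv_norm (tv_add x (tv_neg y))]"

lemma aff_bad_commute: "set (aff_bad x y) = set (aff_bad y x)"
  by (simp add: aff_bad_def third_commute)

lemma proj_bad_commute: "set (proj_bad x y) = set (proj_bad y x)"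
proof -
  have "tv_add x (tv_neg y) = tv_neg (tv_add y (tv_neg x))"
    by (simp add: tv_neg_add tv_add_commute)
  then show ?thesis by (simp add: proj_bad_def tv_add_commute)
qed

fun none_mem :: "tvec list \<Rightarrow> tvec list \<Rightarrow> bool" where
  "none_mem [] ys = True"
| "none_mem (b # bs) ys = (\<not> mem b ys \<and> none_mem bs ys)"

fun check_conflict_free :: "(tvec \<Rightarrow> tvec \<Rightarrow> tvec list) \<Rightarrow> tvec list \<Rightarrow> tvec list \<Rightarrow> bool" where
  "check_conflict_free bad ys [] = True"
| "check_conflict_free bad ys (x # xs) =
     (none_mem (bads bad x xs) ys \<and> check_conflict_free bad ys xs)"

lemma none_mem_iff [simp]: "none_mem bs ys \<longleftrightarrow> set bs \<inter> set ys = {}"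
  by (induction bs) auto

text \<open>The check pairs each entry only with later ones, while ys stays the whole list; symmetry
  of \<open>bad\<close> covers the other order.\<close>

lemma check_conflict_free_pairs:
  assumes "\<And>x y. set (bad x y) = set (bad y x)" and "check_conflict_free bad ys xs"
    and "x \<in> set xs" "y \<in> set xs" "x \<noteq> y"
  shows "set ys \<inter> set (bad x y) = {}"
  using assms(2-)
proof (induction xs)
  case (Cons a xs)
  have a: "set ys \<inter> set (bad a c) = {}" "set ys \<inter> set (bad c a) = {}" if "c \<in> set xs" for c
    using Cons.prems(1) that assms(1)[of a c] by auto
  consider "x = a" "y \<in> set xs" | "y = a" "x \<in> set xs" | "x \<in> set xs" "y \<in> set xs"
    using Cons.prems by auto
  then show ?case using a Cons by cases auto
qed simp

lemma conflict_free_check: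
  assumes "\<And>x y. set (bad x y) = set (bad y x)" and "check_conflict_free bad xs xs"
  shows "conflict_free bad (set xs)"
  using check_conflict_free_pairs[OF assms] unfolding conflict_free_def by blast

section \<open>The standard demicap\<close>

text \<open>
  Two points of the same group are collinear with a point of the standard demicap.
\<close>

definition groups0 :: "tvec list list" where
  "groups0 = [
    [TV TZ TP TP TN, TV TZ TP TN TP, TV TZ TN TP TP],
    [TV TZ TP TN TN, TV TP TZ TN TN, TV TN TN TP TP],
    [TV TZ TN TP TN, TV TP TN TZ TN, TV TN TP TN TP],
    [TV TZ TN TN TP, TV TP TN TN TZ, TV TN TP TP TN],
    [TV TP TZ TP TN, TV TP TZ TN TP, TV TN TZ TP TP],
    [TV TP TP TZ TN, TV TP TN TZ TP, TV TN TP TZ TP],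
    [TV TP TP TN TZ, TV TP TN TP TZ, TV TN TP TP TZ],
    [TV TP TP TN TN, TV TN TN TZ TP, TV TN TN TP TZ],
    [TV TP TN TP TN, TV TN TZ TN TP, TV TN TP TN TZ],
    [TV TP TN TN TP, TV TN TZ TP TN, TV TN TP TZ TN]]"

definition pm :: "tvec list \<Rightarrow> tvec list" where
  "pm xs = xs @ map tv_neg xs"

text \<open>The complements of \<open>demicap0\<close> in the six 20-point caps around it, as found
  by the search. They are symmetric about the origin, so half of the points is listed.\<close>

definition R_family :: "tvec list list" where
  "R_family = map pm [
    [TV TP TN TP TN, TV TP TN TZ TP, TV TP TP TN TZ, TV TP TZ TN TN, TV TZ TP TP TN],
    [TV TP TN TP TZ, TV TP TN TZ TN, TV TP TP TN TN, TV TP TZ TN TP, TV TZ TP TP TN],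
    [TV TP TN TN TP, TV TP TN TP TZ, TV TP TP TZ TN, TV TP TZ TN TN, TV TZ TP TN TP],
    [TV TP TN TN TZ, TV TP TN TZ TP, TV TP TP TN TN, TV TP TZ TP TN, TV TZ TP TN TP],
    [TV TP TN TN TP, TV TP TN TZ TN, TV TP TP TN TZ, TV TP TZ TP TN, TV TZ TP TN TN],
    [TV TP TN TN TZ, TV TP TN TP TN, TV TP TP TZ TN, TV TP TZ TN TP, TV TZ TP TN TN]]"

text \<open>One list serves every member of \<open>R_family\<close>: these are the complements of R
  in the caps through R, whichever R is taken. The first entry is \<open>demicap0\<close>, and any
  two entries share exactly one pair x, - x.\<close>

definition C_family :: "tvec list list" where
  "C_family = map pm [
    [TV TP TP TP TP, TV TP TZ TZ TZ, TV TZ TP TZ TZ, TV TZ TZ TP TZ, TV TZ TZ TZ TP],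
    [TV TP TP TP TN, TV TP TZ TZ TN, TV TZ TP TZ TN, TV TZ TZ TP TN, TV TZ TZ TZ TP],
    [TV TP TP TN TP, TV TP TZ TN TZ, TV TZ TP TN TZ, TV TZ TZ TP TN, TV TZ TZ TP TZ],
    [TV TP TN TP TP, TV TP TN TZ TZ, TV TZ TP TN TZ, TV TZ TP TZ TN, TV TZ TP TZ TZ],
    [TV TP TN TN TN, TV TP TN TZ TZ, TV TP TZ TN TZ, TV TP TZ TZ TN, TV TP TZ TZ TZ],
    [TV TP TN TN TN, TV TP TN TP TP, TV TP TP TN TP, TV TP TP TP TN, TV TP TP TP TP]]"

definition cap0 :: "tvec list" where
  "cap0 = pm [TV TP TP TZ TZ, TV TP TZ TP TZ, TV TP TZ TZ TP, TV TZ TP TP TP,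
     TV TZ TP TP TZ, TV TZ TP TZ TP, TV TP TZ TP TP,
    TV TZ TZ TP TP, TV TP TP TZ TP, TV TP TP TP TZ]"

section \<open>The projective search: ten-point caps disjoint from the given one\<close>

definition ext_points :: "tvec list" where
  "ext_points = filter (\<lambda>x. normed x \<and> \<not> mem x cap0) all_vecs"

text \<open>A cap containing p has at most one further point on each line through p, so these lines,
  without p, are the groups of the search.\<close>

function lines_through :: "tvec \<Rightarrow> tvec list \<Rightarrow> tvec list list" where
  "lines_through p [] = []"
| "lines_through p (x # xs) =
     (x # filter (\<lambda>y. mem p (proj_bad x y)) xs) #
     lines_through p (filter (\<lambda>y. \<not> mem p (proj_bad x y)) xs)"
  by pat_completeness auto
termination by (relation "Wellfounded.measure (length \<circ> snd)") (auto simp: le_imp_less_Suc)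

text \<open>Branching on small groups first roughly halves the search tree.\<close>

definition order_groups :: "'a list list \<Rightarrow> 'a list list" where
  "order_groups gs = filter (\<lambda>g. length g = 1) gs @ filter (\<lambda>g. length g = 2) gs @
     filter (\<lambda>g. length g \<noteq> 1 \<and> length g \<noteq> 2) gs"

text \<open>p is the earliest point of the cap in list order, so only later points are grouped; nine
  points remain to be chosen.\<close>

fun quadrics :: "tvec list \<Rightarrow> tvec list list" where
  "quadrics [] = []"
| "quadrics (p # ps) = csearch proj_bad (replicate 9 ()) [p] (order_groups (lines_through p ps)) @ quadrics ps"

text \<open>Vectors are compared once per cap; afterwards all disjointness tests run on Boolean
  lists of length 30.\<close>

fun mask :: "tvec list \<Rightarrow> tvec list \<Rightarrow> bool list" where
  "mask [] ys = []"
| "mask (x # xs) ys = mem x ys # mask xs ys"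

fun meets :: "bool list \<Rightarrow> bool list \<Rightarrow> bool" where
  "meets (True # xs) (True # ys) = True"
| "meets (False # xs) (y # ys) = meets xs ys"
| "meets (True # xs) (False # ys) = meets xs ys"
| "meets _ _ = False"

fun mates :: "bool list \<Rightarrow> bool list list \<Rightarrow> bool list list" where
  "mates m [] = []"
| "mates m (l # ls) = cons_unless (meets m l) l (mates m ls)"

fun unique_mates :: "bool list list \<Rightarrow> bool" where
  "unique_mates [l, l'] = (\<not> meets l l')"
| "unique_mates _ = False"

text \<open>A greedy certificate instead of a search: the first mate a, its first partner b, the
  first mate c different from both, and any partner of c. As c is neither a nor b, the two pairs
  give different partitions.\<close>

definition two_pairs :: "bool list list \<Rightarrow> bool" where
  "two_pairs ls = (case ls of [] \<Rightarrow> False | a # as \<Rightarrow>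
     (case mates a ls of [] \<Rightarrow> False | b # _ \<Rightarrow>
       (case filter (\<lambda>c. c \<noteq> a \<and> c \<noteq> b) ls of [] \<Rightarrow> False | c # _ \<Rightarrow> mates c ls \<noteq> [])))"

definition products :: "bool list list" where
  "products = concat (map (\<lambda>R. map (\<lambda>D. mask ext_points (R @ D)) C_family) R_family)"

definition check_masks :: "bool list list \<Rightarrow> bool" where
  "check_masks ls \<longleftrightarrow> list_all (\<lambda>m. unique_mates (mates m ls)) products \<and>
     list_all (\<lambda>m. two_pairs (mates m ls)) (filter (\<lambda>m. m \<notin> set products) ls)"

definition check_quadric :: "tvec list \<Rightarrow> bool" where
  "check_quadric xs \<longleftrightarrow> length xs = 10 \<and> distinct xs \<and> list_all (\<lambda>x. mem x ext_points) xs \<and>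
     check_conflict_free proj_bad xs xs"

text \<open>Both checks are put into one predicate of the list, so that a single evaluation of the
  search serves them.\<close>

definition check_quadrics :: "tvec list list \<Rightarrow> bool" where
  "check_quadrics qs \<longleftrightarrow> list_all check_quadric qs \<and> check_masks (map (mask ext_points) qs)"

lemma check_quadrics_ext_points: "check_quadrics (quadrics ext_points)"
  by code_simp

lemma set_ext_points: "set ext_points = {x. normed x \<and> x \<notin> set cap0}"
  by (auto simp: ext_points_def)

lemma Union_lines_through [simp]: "\<Union>(set ` set (lines_through p xs)) = set xs"
  by (induction p xs rule: lines_through.induct) auto

lemma set_order_groups [simp]: "set (order_groups gs) = set gs"
  by (auto simp: order_groups_def)

text \<open>\<open>lines_through\<close> compares points only with the head of a group. That any two
  points of a group are collinear with p is left to evaluation rather than derived from projective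
  geometry.\<close>

fun check_lines :: "tvec list \<Rightarrow> bool" where
  "check_lines [] = True"
| "check_lines (p # ps) =
     (list_all (\<lambda>g. list_all (\<lambda>x. list_all (\<lambda>y. tv_eq x y \<or> mem p (proj_bad x y)) g) g)
        (lines_through p ps) \<and> check_lines ps)"

lemma check_lines_ext_points: "check_lines ext_points"
  by code_simp

lemma quadrics_complete:
  assumes "check_lines xs" "S \<subseteq> set xs" "conflict_free proj_bad S" "card S = 10"
  shows "\<exists>K\<in>set (quadrics xs). set K = S"
  using assms
proof (induction xs)
  case Nil
  then show ?case by simp
next
  case (Cons p ps)
  show ?case
  proof (cases "p \<in> S")
    case True
    have "\<exists>xs\<in>set (csearch proj_bad (replicate 9 ()) [p] (order_groups (lines_through p ps))). set xs = S"
    proof (rule csearch_complete[OF Cons.prems(3)])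
      show "card (S - set [p]) = length (replicate 9 ())" using True Cons.prems(4) by simp
      fix g x y
      assume g: "g \<in> set (order_groups (lines_through p ps))" and xy: "x \<in> S \<inter> set g" "y \<in> S \<inter> set g"
      then have "x = y \<or> p \<in> set (proj_bad x y)"
        using Cons.prems(1) by (auto simp: list_all_iff)
      then show "x = y" using xy True Cons.prems(3) unfolding conflict_free_def by blast
    qed (use True Cons.prems(2) in auto)
    then show ?thesis by auto
  next
    case False
    then have "S \<subseteq> set ps" using Cons.prems(2) by auto
    then show ?thesis using Cons by auto
  qed
qed

definition quadric :: "tvec set \<Rightarrow> bool" where
  "quadric S \<longleftrightarrow> S \<subseteq> set ext_points \<and> conflict_free proj_bad S \<and> card S = 10"

lemma quadric_iff: "quadric S \<longleftrightarrow> S \<in> set ` set (quadrics ext_points)"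
proof
  assume "quadric S"
  then show "S \<in> set ` set (quadrics ext_points)"
    using quadrics_complete[OF check_lines_ext_points] unfolding quadric_def by blast
next
  assume "S \<in> set ` set (quadrics ext_points)"
  then obtain K where K: "K \<in> set (quadrics ext_points)" "S = set K" by blast
  then have "check_quadric K"
    using check_quadrics_ext_points by (simp add: check_quadrics_def list_all_iff)
  then show "quadric S"
    using K(2) unfolding quadric_def check_quadric_def
    using conflict_free_check[of proj_bad K, OF proj_bad_commute]
    by (auto simp: distinct_card list_all_iff)
qed

section \<open>Quadrics as Boolean vectors\<close>

definition char :: "tvec set \<Rightarrow> bool list" where
  "char S = map (\<lambda>x. x \<in> S) ext_points"

lemma mask_eq [simp]: "mask xs ys = map (\<lambda>x. x \<in> set ys) xs"
  by (induction xs) auto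

lemma mates_eq [simp]: "mates m ls = filter (\<lambda>l. \<not> meets m l) ls"
  by (induction ls) auto

lemma meets_map: "meets (map f xs) (map g xs) \<longleftrightarrow> (\<exists>x\<in>set xs. f x \<and> g x)"
proof (induction xs)
  case (Cons x xs)
  then show ?case by (cases "f x"; cases "g x") auto
qed simp

lemma meets_char: "meets (char S) (char S') \<longleftrightarrow> S \<inter> S' \<inter> set ext_points \<noteq> {}"
  unfolding char_def meets_map by auto

lemma char_eq_iff: "char S = char S' \<longleftrightarrow> S \<inter> set ext_points = S' \<inter> set ext_points"
  unfolding char_def by auto

definition quadric_masks :: "bool list list" where
  "quadric_masks = map (mask ext_points) (quadrics ext_points)"

lemma set_quadric_masks: "set quadric_masks = char ` {S. quadric S}"
  unfolding quadric_masks_def quadric_iff by (auto simp: char_def)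

lemma quadric_meets_char: "quadric S \<Longrightarrow> meets (char X) (char S) \<longleftrightarrow> X \<inter> S \<noteq> {}"
  unfolding meets_char quadric_def by blast

lemma quadric_char_eq_iff: "quadric S \<Longrightarrow> quadric S' \<Longrightarrow> char S = char S' \<longleftrightarrow> S = S'"
  unfolding char_eq_iff quadric_def by blast

lemma set_products: "set products = {char (set R \<union> set D) | R D. R \<in> set R_family \<and> D \<in> set C_family}"
  by (fastforce simp: products_def char_def)

lemma check_masks:
  "\<And>m. m \<in> set products \<Longrightarrow> unique_mates (mates m quadric_masks)"
  "\<And>m. m \<in> set quadric_masks \<Longrightarrow> m \<notin> set products \<Longrightarrow> two_pairs (mates m quadric_masks)"
  using check_quadrics_ext_points
  unfolding check_quadrics_def check_masks_def list_all_iff quadric_masks_def by auto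

lemma product_mates:
  assumes "R \<in> set R_family" "D \<in> set C_family"
  obtains L M where "quadric L" "quadric M" "L \<inter> M = {}"
    "\<And>Q. quadric Q \<Longrightarrow> (set R \<union> set D) \<inter> Q = {} \<longleftrightarrow> Q = L \<or> Q = M"
proof -
  let ?m = "char (set R \<union> set D)"
  have "?m \<in> set products" using assms by (auto simp: set_products)
  then have "unique_mates (mates ?m quadric_masks)" by (rule check_masks)
  then obtain l l' where ll: "mates ?m quadric_masks = [l, l']" "\<not> meets l l'"
    by (cases rule: unique_mates.cases[of "mates ?m quadric_masks"]) auto
  have set: "set (mates ?m quadric_masks) = char ` {Q. quadric Q \<and> (set R \<union> set D) \<inter> Q = {}}"
    using quadric_meets_char by (auto simp: set_quadric_masks)
  have "l \<in> set (mates ?m quadric_masks)" "l' \<in> set (mates ?m quadric_masks)"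
    unfolding ll by auto
  then obtain L M where LM: "quadric L" "quadric M" "l = char L" "l' = char M"
    unfolding set by blast
  have "L \<inter> M = {}" using ll(2) LM quadric_meets_char by blast
  moreover have "(set R \<union> set D) \<inter> Q = {} \<longleftrightarrow> Q = L \<or> Q = M" if "quadric Q" for Q
  proof -
    have "(set R \<union> set D) \<inter> Q = {} \<longleftrightarrow> char Q \<in> set (mates ?m quadric_masks)"
      unfolding mates_eq set_filter set_quadric_masks using quadric_meets_char that by blast
    also have "\<dots> \<longleftrightarrow> Q = L \<or> Q = M"
      unfolding ll LM(3,4) using quadric_char_eq_iff[OF that] LM(1,2) by simp
    finally show ?thesis .
  qed
  ultimately show thesis by (rule that[OF LM(1,2)])
qed

lemma two_pairsD:
  assumes "two_pairs ls"
  obtains a b c d where "a \<in> set ls" "b \<in> set ls" "c \<in> set ls" "d \<in> set ls"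
    "\<not> meets a b" "\<not> meets c d" "c \<noteq> a" "c \<noteq> b"
proof -
  from assms obtain a as where a: "ls = a # as"
    by (auto simp: two_pairs_def split: list.splits)
  from assms a obtain b bs where b: "mates a ls = b # bs"
    by (auto simp: two_pairs_def simp del: mates_eq split: list.splits)
  from assms a b obtain c cs where c: "filter (\<lambda>c. c \<noteq> a \<and> c \<noteq> b) ls = c # cs" "mates c ls \<noteq> []"
    by (auto simp: two_pairs_def simp del: mates_eq filter.simps split: list.splits)
  then obtain d ds where d: "mates c ls = d # ds" by (cases "mates c ls") auto
  have "b \<in> set (mates a ls)" unfolding b by simp
  moreover have "d \<in> set (mates c ls)" unfolding d by simp
  moreover have "c \<in> set (filter (\<lambda>c. c \<noteq> a \<and> c \<noteq> b) ls)" unfolding c(1) by simp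
  moreover have "a \<in> set ls" unfolding a by simp
  ultimately show thesis using that by auto
qed

lemma quadric_cases:
  assumes "quadric S"
  obtains (product) R D where "R \<in> set R_family" "D \<in> set C_family"
      "S = (set R \<union> set D) \<inter> set ext_points"
  | (two_pairs) A B C D where "quadric A" "quadric B" "quadric C" "quadric D"
      "S \<inter> A = {}" "S \<inter> B = {}" "S \<inter> C = {}" "S \<inter> D = {}"
      "A \<inter> B = {}" "C \<inter> D = {}" "C \<noteq> A" "C \<noteq> B"
proof (cases "char S \<in> set products")
  case True
  then obtain R D where "R \<in> set R_family" "D \<in> set C_family" "char S = char (set R \<union> set D)"
    unfolding set_products by blast
  then show thesis
    using product assms unfolding char_eq_iff quadric_def by (metis inf.absorb_iff1)
next
  case False
  have "char S \<in> set quadric_masks" using assms by (auto simp: set_quadric_masks)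
  then have "two_pairs (mates (char S) quadric_masks)" using False by (rule check_masks)
  then obtain a b c d where abcd: "a \<in> set (mates (char S) quadric_masks)" "b \<in> set (mates (char S) quadric_masks)"
    "c \<in> set (mates (char S) quadric_masks)" "d \<in> set (mates (char S) quadric_masks)"
    "\<not> meets a b" "\<not> meets c d" "c \<noteq> a" "c \<noteq> b" by (rule two_pairsD)
  have set: "set (mates (char S) quadric_masks) = char ` {Q. quadric Q \<and> S \<inter> Q = {}}"
    using quadric_meets_char by (auto simp: set_quadric_masks)
  obtain A B C D where ABCD: "a = char A" "b = char B" "c = char C" "d = char D"
    and Q: "quadric A" "quadric B" "quadric C" "quadric D"
      "S \<inter> A = {}" "S \<inter> B = {}" "S \<inter> C = {}" "S \<inter> D = {}"
    using abcd(1-4) unfolding set by blast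
  then show thesis
    using two_pairs[OF Q] abcd(5-8) quadric_meets_char[OF Q(2)] quadric_meets_char[OF Q(4)] by blast
qed

section \<open>Evaluated facts about the standard demicap and the products\<close>

lemma check_groups0:
  "list_all (\<lambda>g. list_all (\<lambda>x. list_all (\<lambda>y. tv_eq x y \<or> mem (third x y) demicap0) g) g) groups0"
  by code_simp

text \<open>Apart from the 10 points of the demicap and the 30 grouped points, there are 41 points.
  Each is third on a line through two points of the demicap, hence lies in no cap around it.\<close>

lemma check_cover0:
  "list_all (\<lambda>x. mem x demicap0 \<or> mem x (concat groups0) \<or>
     mem x (concat (map (\<lambda>c. map (third c) (filter (\<lambda>d. \<not> tv_eq c d) demicap0)) demicap0))) all_vecs"
  by code_simp

text \<open>Ten points are missing and there are ten groups, so the bound forces one point from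
  every group. Testing inclusion is enough, as both sets will have 20 points.\<close>

lemma check_search0:
  "list_all (\<lambda>xs. list_ex (\<lambda>R. list_all (\<lambda>x. mem x (demicap0 @ R)) xs) R_family)
     (csearch aff_bad (replicate 10 ()) demicap0 groups0)"
  by code_simp

lemma check_products:
  "list_all (\<lambda>R. list_all (\<lambda>D. length R = 10 \<and> length D = 10 \<and> distinct (R @ D) \<and>
     check_conflict_free aff_bad (R @ D) (R @ D) \<and> none_mem (R @ D) cap0) C_family) R_family"
  by code_simp

lemma check_families:
  "list_all (\<lambda>R. list_all (\<lambda>R'. R = R' \<or> \<not> list_all (\<lambda>x. mem x R') R) R_family) R_family"
  "list_all (\<lambda>R. list_all (\<lambda>R'. R = R' \<or> \<not> list_all (\<lambda>x. mem x R') R) C_family) C_family"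
  "distinct R_family" "distinct C_family" "length R_family = 6" "length C_family = 6"
  by code_simp+

text \<open>Each completed line contributes both of its points, so one line shows up as length
  2.\<close>

definition completing :: "tvec list \<Rightarrow> tvec \<Rightarrow> tvec list" where
  "completing S p = filter (\<lambda>x. mem (third p x) S \<and> \<not> tv_eq x p) S"

lemma check_cap0:
  "list_all (\<lambda>R. list_all (\<lambda>p. mem p cap0 \<longleftrightarrow>
      length (completing demicap0 p) = 2 \<and> length (completing R p) = 2) all_vecs) R_family"
  "\<not> mem origin cap0" "distinct demicap0"
  by code_simp+

lemma demicap0_in_C_family: "\<exists>D\<in>set C_family. set D = set demicap0"
  by (auto simp: C_family_def demicap0_def pm_def)

lemma check_origin:
  "list_all (\<lambda>xs. \<not> mem origin xs) C_family" "list_all (\<lambda>xs. \<not> mem origin xs) R_family"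
  by code_simp+

lemma tv_neg_pm: "x \<in> set (pm xs) \<Longrightarrow> tv_neg x \<in> set (pm xs)"
  by (auto simp: pm_def)

lemma product:
  assumes "R \<in> set R_family" "D \<in> set C_family"
  shows "card (set R) = 10" "card (set D) = 10" "set R \<inter> set D = {}"
    "conflict_free aff_bad (set R \<union> set D)" "(set R \<union> set D) \<inter> set cap0 = {}"
    "\<And>x. x \<in> set R \<union> set D \<Longrightarrow> tv_neg x \<in> set R \<union> set D" "origin \<notin> set R \<union> set D"
proof -
  have c: "length R = 10" "length D = 10" "distinct (R @ D)"
    "check_conflict_free aff_bad (R @ D) (R @ D)" "none_mem (R @ D) cap0"
    using check_products assms unfolding list_all_iff by auto
  show "card (set R) = 10" "card (set D) = 10" "set R \<inter> set D = {}"
    using c by (auto simp: distinct_card)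
  show "conflict_free aff_bad (set R \<union> set D)"
    using conflict_free_check[OF aff_bad_commute c(4)] by simp
  show "(set R \<union> set D) \<inter> set cap0 = {}" using c(5) by simp
  obtain R' D' where "R = pm R'" "D = pm D'"
    using assms unfolding R_family_def C_family_def by auto
  then show "\<And>x. x \<in> set R \<union> set D \<Longrightarrow> tv_neg x \<in> set R \<union> set D"
    using tv_neg_pm by auto
  show "origin \<notin> set R \<union> set D"
    using check_origin assms by (auto simp: list_all_iff)
qed

lemma inj_on_families: "inj_on set (set R_family)" "inj_on set (set C_family)"
proof -
  have *: "inj_on set (set Fs)"
    if "list_all (\<lambda>R. list_all (\<lambda>R'. R = R' \<or> \<not> list_all (\<lambda>x. mem x R') R) Fs) Fs" for Fs
    using that by (intro inj_onI) (auto simp: list_all_iff)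
  show "inj_on set (set R_family)" "inj_on set (set C_family)"
    using check_families(1,2) * by auto
qed

lemma card_families: "card (set ` set R_family) = 6" "card (set ` set C_family) = 6"
  using check_families(3-6) inj_on_families by (simp_all add: card_image distinct_card)

text \<open>R is also disjoint from D' and R' from D, so the parts of one union cannot leak into the
  wrong part of the other.\<close>

lemma product_eq_iff:
  assumes "R \<in> set R_family" "D \<in> set C_family" "R' \<in> set R_family" "D' \<in> set C_family"
  shows "set R \<union> set D = set R' \<union> set D' \<longleftrightarrow> set R = set R' \<and> set D = set D'"
  using product(3)[OF assms(1,2)] product(3)[OF assms(3,4)] product(3)[OF assms(1,4)]
    product(3)[OF assms(3,2)] by blast

lemma caps_containing_demicap0:
  assumes "conflict_free aff_bad X" "card X = 20" "set demicap0 \<subseteq> X"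
  shows "\<exists>R\<in>set R_family. X = set demicap0 \<union> set R"
proof -
  obtain D where D: "D \<in> set C_family" "set D = set demicap0" using demicap0_in_C_family by blast
  have r0: "R \<in> set R_family \<Longrightarrow> card (set demicap0 \<union> set R) = 20" for R
    using product(1-3)[of R D] D by (simp add: card_Un_disjoint Int_commute)
  have c0: "card (set demicap0) = 10"
    using product(2)[OF _ D(1)] D(2) check_families(5)
    by (metis length_0_conv list.set_intros(1) neq_Nil_conv zero_neq_numeral)
  have "\<exists>xs\<in>set (csearch aff_bad (replicate 10 ()) demicap0 groups0). set xs = X"
  proof (rule csearch_complete[OF assms(1,3)])
    show "card (X - set demicap0) = length (replicate 10 ())"
      using assms(2,3) c0 by (simp add: card_Diff_subset)
    show "X \<subseteq> set demicap0 \<union> \<Union>(set ` set groups0)"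
    proof
      fix x assume x: "x \<in> X"
      have "x \<in> set demicap0 \<or> x \<in> \<Union>(set ` set groups0) \<or>
          (\<exists>c\<in>set demicap0. \<exists>d\<in>set demicap0. c \<noteq> d \<and> x = third c d)"
        using check_cover0 by (auto simp: list_all_iff)
      then show "x \<in> set demicap0 \<union> \<Union>(set ` set groups0)"
        using assms(1,3) x unfolding conflict_free_def aff_bad_def by auto
    qed
    fix g x y assume g: "g \<in> set groups0" and xy: "x \<in> X \<inter> set g" "y \<in> X \<inter> set g"
    then have "x = y \<or> third x y \<in> set demicap0"
      using check_groups0 by (auto simp: list_all_iff)
    then show "x = y" using assms(1,3) xy unfolding conflict_free_def aff_bad_def by auto
  qed
  then obtain xs where xs: "xs \<in> set (csearch aff_bad (replicate 10 ()) demicap0 groups0)" "set xs = X"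
    by blast
  then obtain R where R: "R \<in> set R_family" "X \<subseteq> set demicap0 \<union> set R"
    using check_search0 unfolding list_all_iff list_ex_iff by fastforce
  have "X = set demicap0 \<union> set R"
    using R(2) by (rule card_subset_eq[rotated]) (simp_all add: r0[OF R(1)] assms(2))
  with R(1) show ?thesis by blast
qed

section \<open>Symmetric caps and projective caps\<close>

definition pm_hull :: "tvec set \<Rightarrow> tvec set" where
  "pm_hull S = S \<union> tv_neg ` S"

lemma cap0_neg: "tv_neg x \<in> set cap0 \<longleftrightarrow> x \<in> set cap0"
  using tv_neg_pm[of x] tv_neg_pm[of "tv_neg x"] unfolding cap0_def by auto

lemma in_pm_hull_iff:
  assumes "S \<subseteq> set ext_points"
  shows "x \<in> pm_hull S \<longleftrightarrow> tv_norm x \<in> S"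
proof -
  have n: "normed y" if "y \<in> S" for y using assms that by (auto simp: set_ext_points)
  show ?thesis
  proof
    assume "x \<in> pm_hull S"
    then show "tv_norm x \<in> S" using n by (auto simp: pm_hull_def tv_norm_normed)
  next
    assume "tv_norm x \<in> S"
    then show "x \<in> pm_hull S"
      using tv_norm_cases[of x] unfolding pm_hull_def by (metis UnI1 UnI2 imageI tv_neg_neg)
  qed
qed

text \<open>Up to sign, the third point is the sum or the difference of the representatives: one of
  the other two points on their projective line.\<close>

lemma tv_norm_third: "tv_norm (third x y) \<in> set (proj_bad (tv_norm x) (tv_norm y))"
proof -
  have "tv_norm (tv_add (tv_neg x) y) = tv_norm (tv_add x (tv_neg y))" for x y
    by (metis tv_neg_add tv_neg_neg tv_norm_neg)
  moreover have "tv_norm (tv_add (tv_neg x) (tv_neg y)) = tv_norm (tv_add x y)" for x y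
    by (metis tv_neg_add tv_norm_neg)
  ultimately show ?thesis
    using tv_norm_cases[of x] tv_norm_cases[of y]
    by (auto simp: proj_bad_def third_def)
qed

lemma pm_hull_disjoint:
  assumes "S \<subseteq> set ext_points" "S' \<subseteq> set ext_points"
  shows "pm_hull S \<inter> pm_hull S' = {} \<longleftrightarrow> S \<inter> S' = {}"
proof -
  have "tv_norm x = x" if "x \<in> S" for x using assms that by (auto simp: set_ext_points tv_norm_normed)
  then show ?thesis using in_pm_hull_iff[OF assms(1)] in_pm_hull_iff[OF assms(2)] by (metis disjoint_iff)
qed

lemma pm_hull_Int_ext_points:
  assumes "S \<subseteq> set ext_points"
  shows "pm_hull S \<inter> set ext_points = S"
proof -
  have "x \<in> pm_hull S \<longleftrightarrow> x \<in> S" if "x \<in> set ext_points" for x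
    using in_pm_hull_iff[OF assms, of x] that by (simp add: set_ext_points tv_norm_normed)
  then show ?thesis using assms by auto
qed

lemma pm_hull_eq_iff:
  assumes "S \<subseteq> set ext_points" "S' \<subseteq> set ext_points"
  shows "pm_hull S = pm_hull S' \<longleftrightarrow> S = S'"
  by (metis pm_hull_Int_ext_points[OF assms(1)] pm_hull_Int_ext_points[OF assms(2)])

definition sym_cap :: "tvec set \<Rightarrow> bool" where
  "sym_cap X \<longleftrightarrow> conflict_free aff_bad X \<and> card X = 20 \<and> origin \<notin> X \<and> (\<forall>x\<in>X. tv_neg x \<in> X)
     \<and> X \<inter> set cap0 = {}"

lemma card_pm_hull:
  assumes "S \<subseteq> set ext_points"
  shows "card (pm_hull S) = 2 * card S"
proof -
  have n: "normed x" if "x \<in> S" for x using assms that by (auto simp: set_ext_points)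
  have "S \<inter> tv_neg ` S = {}"
    using n normed_neg not_normed_origin by (metis (no_types, lifting) disjoint_iff imageE)
  moreover have "card (tv_neg ` S) = card S"
    by (intro card_image inj_onI) (metis tv_neg_neg)
  ultimately show ?thesis by (simp add: pm_hull_def card_Un_disjoint)
qed

text \<open>Two points of the hull are either antipodal, with the origin as third point, or
  represent different projective points, whose line contains no further point of S.\<close>

lemma sym_cap_pm_hull:
  assumes "quadric S"
  shows "sym_cap (pm_hull S)"
proof -
  have ext: "S \<subseteq> set ext_points" and cf: "conflict_free proj_bad S" and c: "card S = 10"
    using assms by (auto simp: quadric_def)
  note in_iff = in_pm_hull_iff[OF ext]
  have or: "origin \<notin> pm_hull S"
    unfolding in_iff using ext by (auto simp: tv_norm_def set_ext_points)
  have "third x y \<notin> pm_hull S" if "x \<in> pm_hull S" "y \<in> pm_hull S" "x \<noteq> y" for x y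
  proof (cases "tv_norm x = tv_norm y")
    case True
    then have "y = tv_neg x"
      using \<open>x \<noteq> y\<close> tv_norm_cases[of x] tv_norm_cases[of y] by (metis tv_neg_neg)
    then show ?thesis using or by (simp add: third_def)
  next
    case False
    then have "tv_norm (third x y) \<notin> S"
      using that(1,2) cf tv_norm_third[of x y] unfolding in_iff conflict_free_def by blast
    then show ?thesis by (simp add: in_iff)
  qed
  then have "conflict_free aff_bad (pm_hull S)" by (auto simp: conflict_free_def aff_bad_def)
  moreover have "tv_neg x \<in> pm_hull S" if "x \<in> pm_hull S" for x using that by (auto simp: pm_hull_def)
  moreover have "pm_hull S \<inter> set cap0 = {}"
    using ext by (auto simp: pm_hull_def set_ext_points cap0_neg)
  ultimately show ?thesis using or card_pm_hull[OF ext] c by (simp add: sym_cap_def)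
qed

text \<open>Conversely, the affine lines through x, y and through x, - y account for both remaining
  points of the projective line, and symmetry excludes either representative of each.\<close>

lemma sym_cap_quadric:
  assumes "sym_cap X"
  shows "quadric (X \<inter> set ext_points)" "pm_hull (X \<inter> set ext_points) = X"
proof -
  let ?S = "X \<inter> set ext_points"
  have neg: "tv_neg x \<in> X" if "x \<in> X" for x using assms that by (auto simp: sym_cap_def)
  have norm: "tv_norm x \<in> ?S" if "x \<in> X" for x
  proof -
    have "x \<noteq> origin" using that assms by (auto simp: sym_cap_def)
    then have "normed (tv_norm x)" by (simp add: tv_norm_def normed_neg)
    moreover have "tv_norm x \<in> X" using tv_norm_cases[of x] neg that by metis
    ultimately show ?thesis using assms by (auto simp: set_ext_points sym_cap_def)
  qed
  have "x \<in> pm_hull ?S" if "x \<in> X" for x using norm[OF that] by (simp add: in_pm_hull_iff)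
  moreover have "pm_hull ?S \<subseteq> X" using neg by (auto simp: pm_hull_def)
  ultimately show eq: "pm_hull ?S = X" by blast
  have cf: "third x y \<notin> X" if "x \<in> X" "y \<in> X" "x \<noteq> y" for x y
    using assms that unfolding sym_cap_def conflict_free_def aff_bad_def by auto
  have n: "normed x" if "x \<in> ?S" for x using that by (auto simp: set_ext_points)
  have "?S \<inter> set (proj_bad x y) = {}" if xy: "x \<in> ?S" "y \<in> ?S" "x \<noteq> y" for x y
  proof -
    have "x \<noteq> tv_neg y" using n[OF xy(1)] n[OF xy(2)] normed_neg[of y] not_normed_origin by metis
    then have "third x y \<notin> X" "third x (tv_neg y) \<notin> X" using xy cf neg by auto
    then have "tv_norm (tv_add x y) \<notin> X" "tv_norm (tv_add x (tv_neg y)) \<notin> X"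
      using neg tv_norm_cases unfolding third_def by (metis tv_neg_neg)+
    then show ?thesis by (simp add: proj_bad_def)
  qed
  then have "conflict_free proj_bad ?S" by (auto simp: conflict_free_def)
  moreover have "card ?S = 10" using card_pm_hull[of ?S] eq assms by (simp add: sym_cap_def)
  ultimately show "quadric ?S" by (simp add: quadric_def)
qed

section \<open>Partitions containing a given cap\<close>

text \<open>The size 20 enters as an assumption on all maximal caps; the theorem supplies it from
  C'.\<close>

locale anchored_cap =
  fixes C :: "pt set" and a :: pt
  assumes max_cap_iff: "max_cap M \<longleftrightarrow> is_cap M \<and> card M = 20"
    and max_cap: "max_cap C" and anchor: "anchor C a"
begin

definition sibling :: "pt set \<Rightarrow> bool" where
  "sibling M \<longleftrightarrow> is_cap M \<and> card M = 20 \<and> anchor M a \<and> M \<inter> C = {}"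

definition partitions :: "pt set \<Rightarrow> pt set set set" where
  "partitions K = {Q. (\<exists>b. cap_partition b Q) \<and> C \<in> Q \<and> K \<in> Q}"

lemma completable_1_iff: "completable 1 C K \<longleftrightarrow> max_cap K \<and> C \<inter> K = {} \<and> card (partitions K) = 1"
  unfolding completable_def partitions_def using max_cap by simp

lemma partition_anchor:
  assumes "cap_partition b Q" "C \<in> Q"
  shows "b = a"
proof -
  have "is_cap C" "C \<noteq> {}" using max_cap by (auto simp: max_cap_iff)
  moreover have "anchor C b" using assms by (auto simp: cap_partition_def)
  ultimately show ?thesis using anchor anchor_unique by blast
qed

lemma partition_sibling:
  assumes "Q \<in> partitions K" "M \<in> Q" "M \<noteq> C"
  shows "sibling M"
proof -
  obtain b where b: "cap_partition b Q" "C \<in> Q" using assms(1) by (auto simp: partitions_def)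
  then have "b = a" by (rule partition_anchor)
  with b assms(2,3) show ?thesis
    unfolding sibling_def cap_partition_def disjoint_def max_cap_iff by blast
qed

lemma completable_sibling:
  assumes "completable 1 C K"
  shows "sibling K"
proof -
  have K: "max_cap K" "C \<inter> K = {}" "card (partitions K) = 1"
    using assms unfolding completable_1_iff by blast+
  then obtain Q where Q: "Q \<in> partitions K" by (metis card.empty ex_in_conv zero_neq_one)
  have "K \<noteq> C" using K by (auto simp: max_cap_iff)
  moreover have "K \<in> Q" using Q by (auto simp: partitions_def)
  ultimately show ?thesis using partition_sibling[OF Q] by blast
qed

lemma sibling_nonempty: "sibling M \<Longrightarrow> M \<noteq> {}"
  by (auto simp: sibling_def)

lemma partition_elements:
  assumes "Q \<in> partitions K" "sibling K"
  obtains L M where "Q = {C, K, L, M}" "sibling L" "sibling M" "K \<inter> L = {}" "K \<inter> M = {}"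
    "L \<noteq> M"
proof -
  obtain b where b: "cap_partition b Q" "C \<in> Q" "K \<in> Q"
    using assms(1) by (auto simp: partitions_def)
  have KC: "K \<noteq> C" using assms(2) sibling_nonempty unfolding sibling_def by blast
  have Q4: "card Q = 4" and dis: "disjoint Q" using b(1) by (auto simp: cap_partition_def)
  have "card (Q - {C, K}) = 2"
    using Q4 b(2,3) KC by (subst card_Diff_subset) auto
  then obtain L M where LM: "Q - {C, K} = {L, M}" "L \<noteq> M" by (auto simp: card_2_iff)
  then have in_Q: "L \<in> Q" "M \<in> Q" "L \<noteq> C" "L \<noteq> K" "M \<noteq> C" "M \<noteq> K" by blast+
  have "Q = {C, K, L, M}" using LM(1) b(2,3) by blast
  moreover have "sibling L" "sibling M" using partition_sibling[OF assms(1)] in_Q by auto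
  moreover have "K \<inter> L = {}" "K \<inter> M = {}" using dis in_Q b(3) unfolding disjoint_def by blast+
  ultimately show thesis using LM(2) by (intro that)
qed

text \<open>Four disjoint 20-point caps missing a have 80 points in all, so together with a they
  exhaust the space.\<close>

lemma partition_intro:
  assumes "sibling K" "sibling L" "sibling M" "K \<inter> L = {}" "K \<inter> M = {}" "L \<inter> M = {}"
  shows "{C, K, L, M} \<in> partitions K"
proof -
  let ?Q = "{C, K, L, M}"
  have C: "is_cap C" "card C = 20" using max_cap by (auto simp: max_cap_iff)
  have s: "card K = 20" "card L = 20" "card M = 20" "K \<inter> C = {}" "L \<inter> C = {}" "M \<inter> C = {}"
    "K \<noteq> {}" "L \<noteq> {}" "M \<noteq> {}"
    using assms(1-3) sibling_nonempty by (auto simp: sibling_def)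
  have ne: "C \<noteq> K" "C \<noteq> L" "C \<noteq> M" "K \<noteq> L" "K \<noteq> M" "L \<noteq> M"
    using s assms(4-6) by auto
  have mc: "max_cap X \<and> anchor X a" if "X \<in> ?Q" for X
    using that assms(1-3) max_cap anchor unfolding sibling_def max_cap_iff by blast
  then have "a \<notin> \<Union>?Q" unfolding anchor_iff by blast
  moreover have "card (\<Union>?Q) = 80"
  proof -
    have "\<Union>?Q = C \<union> (K \<union> (L \<union> M))" by auto
    also have "card \<dots> = card C + card (K \<union> (L \<union> M))"
      using s by (intro card_Un_disjoint) auto
    also have "card (K \<union> (L \<union> M)) = card K + card (L \<union> M)"
      using assms by (intro card_Un_disjoint) auto
    also have "card (L \<union> M) = card L + card M"
      using assms by (intro card_Un_disjoint) auto
    finally show ?thesis using s C by simp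
  qed
  ultimately have "card (insert a (\<Union>?Q)) = card (UNIV :: pt set)"
    unfolding card_pt by (simp del: Union_insert)
  then have "insert a (\<Union>?Q) = UNIV" by (intro card_subset_eq) auto
  moreover have "disjoint ?Q"
    using s assms(4-6) unfolding disjoint_def by (auto simp: Int_commute)
  moreover have "card ?Q = 4" using ne by simp
  ultimately have "cap_partition a ?Q"
    using mc \<open>a \<notin> \<Union>?Q\<close> unfolding cap_partition_def by blast
  then show ?thesis unfolding partitions_def by blast
qed

lemma completable_if_unique_mates:
  assumes "sibling K" "sibling L" "sibling M" "K \<inter> L = {}" "K \<inter> M = {}" "L \<inter> M = {}"
    and mates: "\<And>N. sibling N \<Longrightarrow> K \<inter> N = {} \<Longrightarrow> N = L \<or> N = M"
  shows "completable 1 C K"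
proof -
  have "Q = {C, K, L, M}" if Q: "Q \<in> partitions K" for Q
  proof -
    obtain L' M' where Q': "Q = {C, K, L', M'}" "sibling L'" "sibling M'" "K \<inter> L' = {}" "K \<inter> M' = {}"
      "L' \<noteq> M'" using partition_elements[OF Q assms(1)] .
    then have "{L', M'} = {L, M}" using mates[of L'] mates[of M'] by auto
    then show ?thesis using Q'(1) by auto
  qed
  then have "partitions K = {{C, K, L, M}}"
    using partition_intro[OF assms(1-6)] by blast
  moreover have "max_cap K" "C \<inter> K = {}" using assms(1) by (auto simp: sibling_def max_cap_iff)
  ultimately show ?thesis unfolding completable_1_iff by simp
qed

lemma not_completable_if_two_pairs:
  assumes "sibling K" "sibling L" "sibling M" "K \<inter> L = {}" "K \<inter> M = {}" "L \<inter> M = {}"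
    "sibling L'" "sibling M'" "K \<inter> L' = {}" "K \<inter> M' = {}" "L' \<inter> M' = {}" "L' \<noteq> L" "L' \<noteq> M"
  shows "\<not> completable 1 C K"
proof
  assume "completable 1 C K"
  then have "card (partitions K) = 1" unfolding completable_1_iff by blast
  then obtain Q where Q: "partitions K = {Q}" by (rule card_1_singletonE)
  have "{C, K, L, M} = Q"
    by (rule singletonD) (use partition_intro[OF assms(1-6)] Q in \<open>simp only:\<close>)
  moreover have "{C, K, L', M'} = Q"
    by (rule singletonD) (use partition_intro[OF assms(1,7-11)] Q in \<open>simp only:\<close>)
  ultimately have "{C, K, L, M} = {C, K, L', M'}" by (simp only:)
  then have "L' \<in> {C, K, L, M}" by (simp only: insert_iff simp_thms)
  moreover have "L' \<noteq> C" "L' \<noteq> K" using assms(7,9) sibling_nonempty[OF assms(7)] by (auto simp: sibling_def)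
  ultimately show False using assms(12,13) by blast
qed

end

section \<open>Caps in the coordinates of a frame\<close>

context frame
begin

lemma \<phi>_eq_iff [simp]: "\<phi> x = \<phi> y \<longleftrightarrow> x = y"
  using bij by (auto simp: bij_def inj_eq)

lemma \<phi>_image_eq_iff [simp]: "\<phi> ` X = \<phi> ` Y \<longleftrightarrow> X = Y"
  by (auto simp: inj_image_eq_iff bij_is_inj[OF bij])

lemma \<phi>_in_image_iff [simp]: "\<phi> x \<in> \<phi> ` X \<longleftrightarrow> x \<in> X"
  by auto

lemma \<phi>_disjoint_iff: "\<phi> ` X \<inter> \<phi> ` Y = {} \<longleftrightarrow> X \<inter> Y = {}"
  by auto

lemma card_image_\<phi> [simp]: "card (\<phi> ` X) = card X"
  by (intro card_image inj_onI) simp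

lemma preimageE: obtains X where "K = \<phi> ` X"
  using bij by (metis bij_is_surj surj_image_vimage_eq)

lemma \<phi>_surjE: obtains x where "p = \<phi> x"
  using bij by (metis bij_pointE)

lemma is_cap_image: "is_cap (\<phi> ` X) \<longleftrightarrow> conflict_free aff_bad X"
  unfolding is_cap_iff conflict_free_def aff_bad_def
  by (simp add: third[symmetric])

lemma anchor_image: "anchor (\<phi> ` X) (\<phi> origin) \<longleftrightarrow> origin \<notin> X \<and> (\<forall>x\<in>X. tv_neg x \<in> X)"
  unfolding anchor_iff by (simp add: third[symmetric] third_origin)

lemma completes_image:
  assumes "distinct xs"
  shows "completes (\<phi> ` set xs) (\<phi> p) = 1 \<longleftrightarrow> length (completing xs p) = 2"
proof -
  have "{x \<in> \<phi> ` set xs. - \<phi> p - x \<in> \<phi> ` set xs \<and> x \<noteq> \<phi> p} = \<phi> ` set (completing xs p)"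
    unfolding completing_def by (auto simp: third[symmetric])
  moreover have "card (set (completing xs p)) = length (completing xs p)"
    using assms by (intro distinct_card) (simp add: completing_def)
  ultimately show ?thesis unfolding completes_eq_1_iff by simp
qed

lemma Phi_image:
  assumes R: "R \<in> set R_family"
  shows "Phi (\<phi> ` set demicap0) (\<phi> ` set R) = \<phi> ` set cap0"
proof -
  obtain D where D: "D \<in> set C_family" "set D = set demicap0" using demicap0_in_C_family by blast
  note pr = product[OF R D(1), unfolded D(2)]
  have "distinct R" using check_products R D(1) by (auto simp: list_all_iff)
  note comp = completes_image[OF this] completes_image[OF check_cap0(3)]
  have mem: "p \<in> set cap0 \<longleftrightarrow> length (completing demicap0 p) = 2 \<and> length (completing R p) = 2" for p
    using check_cap0(1) R by (simp add: list_all_iff)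
  let ?K = "\<phi> ` set demicap0 \<union> \<phi> ` set R"
  have K: "?K = \<phi> ` (set R \<union> set demicap0)" by auto
  have "is_cap ?K" using pr(4) unfolding K is_cap_image .
  moreover have "anchor ?K (\<phi> origin)" using pr(6,7) unfolding K anchor_image by blast
  moreover have "?K \<noteq> {}" by (simp add: demicap0_def)
  \<comment> \<open>\<open>Phi\<close> excludes every anchor of the union. There is only this one,
    and it is not in the image of \<open>cap0\<close> anyway.\<close>
  ultimately have anc: "b = \<phi> origin" if "anchor ?K b" for b
    using anchor_unique that by blast
  have "p \<in> Phi (\<phi> ` set demicap0) (\<phi> ` set R) \<longleftrightarrow> p \<in> \<phi> ` set cap0" for p
  proof -
    obtain x where x: "p = \<phi> x" by (rule \<phi>_surjE)
    have "x \<notin> set R \<union> set demicap0 \<and> x \<noteq> origin" if "x \<in> set cap0"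
      using that pr(5) check_cap0(2) by auto
    then show ?thesis
      unfolding Phi_def x using mem[of x] comp[of x] anc[of "\<phi> x"] by auto
  qed
  then show ?thesis by blast
qed

lemma caps_containing:
  "{K. is_cap K \<and> card K = 20 \<and> \<phi> ` set demicap0 \<subseteq> K} =
   (\<lambda>X. \<phi> ` set demicap0 \<union> \<phi> ` X) ` (set ` set R_family)" (is "?A = ?B")
proof (intro equalityI subsetI)
  fix K assume K: "K \<in> ?A"
  obtain X where X: "K = \<phi> ` X" by (rule preimageE)
  have "conflict_free aff_bad X" "card X = 20" "set demicap0 \<subseteq> X"
    using K X is_cap_image by auto
  then obtain R where "R \<in> set R_family" "X = set demicap0 \<union> set R"
    using caps_containing_demicap0 by blast
  then show "K \<in> ?B" unfolding X by (auto simp: image_Un)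
next
  fix K assume "K \<in> ?B"
  then obtain R where R: "R \<in> set R_family" "K = \<phi> ` (set R \<union> set demicap0)" by (auto simp: image_Un Un_commute)
  obtain D where D: "D \<in> set C_family" "set D = set demicap0" using demicap0_in_C_family by blast
  note pr = product[OF R(1) D(1), unfolded D(2)]
  have "card (set R \<union> set demicap0) = 20" using pr(1-3) by (simp add: card_Un_disjoint)
  then show "K \<in> ?A" using R(2) pr(4) is_cap_image by auto
qed

text \<open>Valid in every frame, hence also in that of the second demicap, where the bare number is
  what gets used.\<close>

lemma card_caps_containing:
  "card {K. is_cap K \<and> card K = 20 \<and> \<phi> ` set demicap0 \<subseteq> K} = 6"
proof -
  obtain D where D: "D \<in> set C_family" "set D = set demicap0" using demicap0_in_C_family by blast
  have "inj_on (\<lambda>X. \<phi> ` set demicap0 \<union> \<phi> ` X) (set ` set R_family)"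
  proof (rule inj_onI)
    fix X Y assume XY: "X \<in> set ` set R_family" "Y \<in> set ` set R_family"
      and "\<phi> ` set demicap0 \<union> \<phi> ` X = \<phi> ` set demicap0 \<union> \<phi> ` Y"
    then have eq: "X \<union> set D = Y \<union> set D" unfolding D(2) image_Un[symmetric] by (simp add: Un_commute)
    then show "X = Y" using XY product_eq_iff[OF _ D(1) _ D(1)] by blast
  qed
  then show ?thesis unfolding caps_containing using card_families by (simp add: card_image)
qed

text \<open>Blocks other than C correspond to symmetric caps in coordinates and these to quadrics,
  and both passages preserve disjointness. The evaluated mates then give one partition for a product
  and at least two otherwise.\<close>

lemma completable_iff_product:
  assumes "anchored_cap (\<phi> ` set cap0) (\<phi> origin)"
  shows "completable 1 (\<phi> ` set cap0) K \<longleftrightarrow>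
    (\<exists>R\<in>set R_family. \<exists>D\<in>set C_family. K = \<phi> ` (set R \<union> set D))"
proof -
  interpret anchored_cap "\<phi> ` set cap0" "\<phi> origin" by fact
  have sib: "sibling (\<phi> ` X) \<longleftrightarrow> sym_cap X" for X
    unfolding sibling_def sym_cap_def is_cap_image anchor_image \<phi>_disjoint_iff by auto
  have sibQ: "sibling (\<phi> ` pm_hull S)" if "quadric S" for S
    using sib sym_cap_pm_hull[OF that] by blast
  have dis: "\<phi> ` pm_hull S \<inter> \<phi> ` pm_hull S' = {} \<longleftrightarrow> S \<inter> S' = {}" if "quadric S" "quadric S'" for S S'
    unfolding \<phi>_disjoint_iff using pm_hull_disjoint that by (simp add: quadric_def)
  have prod: "sym_cap (set R \<union> set D)" if "R \<in> set R_family" "D \<in> set C_family" for R D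
    using product[OF that] by (simp add: sym_cap_def card_Un_disjoint del: Un_iff)
  show ?thesis
  proof
    assume comp: "completable 1 (\<phi> ` set cap0) K"
    obtain X where X: "K = \<phi> ` X" by (rule preimageE)
    have "sym_cap X" using completable_sibling[OF comp] X sib by simp
    from sym_cap_quadric[OF this] have q: "quadric (X \<inter> set ext_points)"
      and h: "pm_hull (X \<inter> set ext_points) = X" .
    from q show "\<exists>R\<in>set R_family. \<exists>D\<in>set C_family. K = \<phi> ` (set R \<union> set D)"
    proof (cases rule: quadric_cases)
      case (product R D)
      \<comment> \<open>Both sides are the hulls of the same set of normed representatives.\<close>
      then have "X = set R \<union> set D" using h sym_cap_quadric(2)[OF prod[OF product(1,2)]] by metis
      then show ?thesis using product X by blast
    next
      case (two_pairs A B C D)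
      let ?h = "\<lambda>S. \<phi> ` pm_hull S"
      have "?h C \<noteq> ?h A" "?h C \<noteq> ?h B"
        using two_pairs by (simp_all add: pm_hull_eq_iff quadric_def)
      moreover have "K = ?h (X \<inter> set ext_points)" using X h by simp
      ultimately have "\<not> completable 1 (\<phi> ` set cap0) K"
        using two_pairs q
        by (intro not_completable_if_two_pairs[of K "?h A" "?h B" "?h C" "?h D"]) (simp_all add: sibQ dis)
      then show ?thesis using comp by blast
    qed
  next
    assume "\<exists>R\<in>set R_family. \<exists>D\<in>set C_family. K = \<phi> ` (set R \<union> set D)"
    then obtain R D where R: "R \<in> set R_family" and D: "D \<in> set C_family"
      and K: "K = \<phi> ` (set R \<union> set D)" by blast
    let ?S = "(set R \<union> set D) \<inter> set ext_points"
    let ?h = "\<lambda>S. \<phi> ` pm_hull S"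
    have q: "quadric ?S" and h: "pm_hull ?S = set R \<union> set D"
      using sym_cap_quadric[OF prod[OF R D]] by auto
    have KS: "K = ?h ?S" using K h by simp
    obtain L M where LM: "quadric L" "quadric M" "L \<inter> M = {}"
      and mates: "\<And>Q. quadric Q \<Longrightarrow> (set R \<union> set D) \<inter> Q = {} \<longleftrightarrow> Q = L \<or> Q = M"
      using product_mates[OF R D] by blast
    have S: "?S \<inter> Q = {} \<longleftrightarrow> Q = L \<or> Q = M" if "quadric Q" for Q
      using mates[OF that] that unfolding quadric_def by blast
    show "completable 1 (\<phi> ` set cap0) K"
      unfolding KS
    proof (rule completable_if_unique_mates)
      show "sibling (?h ?S)" "sibling (?h L)" "sibling (?h M)" using q LM sibQ by auto
      show "?h ?S \<inter> ?h L = {}" using dis[OF q LM(1)] S[OF LM(1)] by simp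
      show "?h ?S \<inter> ?h M = {}" using dis[OF q LM(2)] S[OF LM(2)] by simp
      show "?h L \<inter> ?h M = {}" using dis[OF LM(1,2)] LM(3) by simp
      fix N assume N: "sibling N" "?h ?S \<inter> N = {}"
      obtain Y where Y: "N = \<phi> ` Y" by (rule preimageE)
      have "sym_cap Y" using N(1) Y sib by simp
      from sym_cap_quadric[OF this] have q': "quadric (Y \<inter> set ext_points)"
        and h': "pm_hull (Y \<inter> set ext_points) = Y" .
      have "?S \<inter> (Y \<inter> set ext_points) = {}" using dis[OF q q'] N(2) Y h' by simp
      then have "Y \<inter> set ext_points = L \<or> Y \<inter> set ext_points = M" using S[OF q'] by blast
      then show "N = ?h L \<or> N = ?h M" using Y h' by metis
    qed
  qed
qed

end

section \<open>Back to AG(4,3): the two families and their 36 products\<close>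

theorem theorem5p1:
  fixes C C' C1 R1 :: "pt set"
  assumes "completable 1 C C'"
    and "C' = C1 \<union> R1" and "C1 \<inter> R1 = {}"
    and "demicap C1" and "demicap R1"
    and "Phi C1 R1 = C"
  defines "Rs \<equiv> {K - C1 | K. max_cap K \<and> C1 \<subseteq> K}"
    and "Cs \<equiv> {K - R1 | K. max_cap K \<and> R1 \<subseteq> K}"
  shows "card {K. max_cap K \<and> C1 \<subseteq> K} = 6 \<and>
         card {K. max_cap K \<and> R1 \<subseteq> K} = 6 \<and>
         (\<forall>R\<in>Rs. \<forall>D\<in>Cs. max_cap (R \<union> D)) \<and>
         {R \<union> D | R D. R \<in> Rs \<and> D \<in> Cs} = {K. completable 1 C K} \<and>
         card {K. completable 1 C K} = 36"
proof -
  have mC: "max_cap C" and mC': "max_cap C'" using assms(1) by (auto simp: completable_def)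
  have card10: "card C1 = 10" "card R1 = 10"
    using assms(4,5) by (auto simp: demicap_def demicap_anchor_def)
  then have C'20: "card C' = 20" using assms(2,3) by (simp add: card_Un_disjoint)
  have max_iff: "max_cap K \<longleftrightarrow> is_cap K \<and> card K = 20" for K
    using mC' C'20 unfolding max_cap_def by (metis le_antisym)
  obtain \<phi> where fr: "frame \<phi>" and C1: "C1 = \<phi> ` set demicap0" using demicap_frame[OF assms(4)] .
  \<comment> \<open>This frame is unrelated to \<open>\<phi>\<close>; it serves only to count the
    caps through R1.\<close>
  obtain \<psi> where fr': "frame \<psi>" and R1': "R1 = \<psi> ` set demicap0" using demicap_frame[OF assms(5)] .
  interpret frame \<phi> by fact
  have caps1: "{K. max_cap K \<and> C1 \<subseteq> K} = (\<lambda>X. C1 \<union> \<phi> ` X) ` (set ` set R_family)"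
    using caps_containing unfolding max_iff C1 conj_assoc .
  have n1: "card {K. max_cap K \<and> C1 \<subseteq> K} = 6"
    using card_caps_containing unfolding max_iff C1 conj_assoc .
  have n2: "card {K. max_cap K \<and> R1 \<subseteq> K} = 6"
    using frame.card_caps_containing[OF fr'] unfolding max_iff R1' conj_assoc .
  obtain D0 where D0: "D0 \<in> set C_family" "set D0 = set demicap0" using demicap0_in_C_family by blast
  have C1R: "C1 \<inter> \<phi> ` set R = {}" if "R \<in> set R_family" for R
    using product(3)[OF that D0(1)] unfolding C1 D0(2) \<phi>_disjoint_iff by blast
  have "C' \<in> {K. max_cap K \<and> C1 \<subseteq> K}" using mC' assms(2) by auto
  then obtain R0 where R0: "R0 \<in> set R_family" and "C' = C1 \<union> \<phi> ` set R0" unfolding caps1 by blast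
  then have R1: "R1 = \<phi> ` set R0" using assms(2,3) C1R[OF R0] by blast
  have C: "C = \<phi> ` set cap0" using assms(6) Phi_image[OF R0] unfolding C1 R1 by simp
  have prod_max: "max_cap (\<phi> ` (set R \<union> set D))" if "R \<in> set R_family" "D \<in> set C_family" for R D
    using product[OF that] unfolding max_iff is_cap_image by (simp add: card_Un_disjoint)
  have Rs: "Rs = (\<lambda>R. \<phi> ` set R) ` set R_family"
  proof -
    have "Rs = (\<lambda>K. K - C1) ` {K. max_cap K \<and> C1 \<subseteq> K}" unfolding Rs_def by blast
    also have "\<dots> = (\<lambda>R. (C1 \<union> \<phi> ` set R) - C1) ` set R_family" unfolding caps1 by (simp add: image_image)
    also have "\<dots> = (\<lambda>R. \<phi> ` set R) ` set R_family"
      using C1R by (intro image_cong) auto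
    finally show ?thesis .
  qed
  have caps2: "{K. max_cap K \<and> R1 \<subseteq> K} = (\<lambda>X. R1 \<union> \<phi> ` X) ` (set ` set C_family)"
  \<comment> \<open>The six explicit products are caps through R1; since there are only six such
    caps, the inclusion is an equality.\<close>
  proof (rule card_subset_eq[symmetric])
    show "finite {K. max_cap K \<and> R1 \<subseteq> K}" by simp
    show "(\<lambda>X. R1 \<union> \<phi> ` X) ` (set ` set C_family) \<subseteq> {K. max_cap K \<and> R1 \<subseteq> K}"
      using prod_max[OF R0] unfolding R1 by (auto simp: image_Un)
    have "inj_on (\<lambda>X. R1 \<union> \<phi> ` X) (set ` set C_family)"
    proof (rule inj_onI)
      fix X Y assume "X \<in> set ` set C_family" "Y \<in> set ` set C_family" "R1 \<union> \<phi> ` X = R1 \<union> \<phi> ` Y"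
      then show "X = Y"
        using product_eq_iff[OF R0 _ R0] unfolding R1 image_Un[symmetric] \<phi>_image_eq_iff by blast
    qed
    then show "card ((\<lambda>X. R1 \<union> \<phi> ` X) ` (set ` set C_family)) = card {K. max_cap K \<and> R1 \<subseteq> K}"
      using n2 card_families by (simp add: card_image)
  qed
  have Cs: "Cs = (\<lambda>D. \<phi> ` set D) ` set C_family"
  proof -
    have "Cs = (\<lambda>K. K - R1) ` {K. max_cap K \<and> R1 \<subseteq> K}" unfolding Cs_def by blast
    also have "\<dots> = (\<lambda>D. (R1 \<union> \<phi> ` set D) - R1) ` set C_family" unfolding caps2 by (simp add: image_image)
    also have "\<dots> = (\<lambda>D. \<phi> ` set D) ` set C_family"
    proof (rule image_cong)
      fix D assume "D \<in> set C_family"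
      then have "R1 \<inter> \<phi> ` set D = {}"
        using product(3)[OF R0] unfolding R1 \<phi>_disjoint_iff by blast
      then show "(R1 \<union> \<phi> ` set D) - R1 = \<phi> ` set D" by blast
    qed simp
    finally show ?thesis .
  qed
  have "anchor C (\<phi> origin)"
    unfolding C anchor_image using check_cap0(2) cap0_neg by simp
  then have "anchored_cap (\<phi> ` set cap0) (\<phi> origin)"
    using max_iff mC unfolding C by unfold_locales
  from completable_iff_product[OF this]
  have comp: "{K. completable 1 C K} =
      (\<lambda>(X, Y). \<phi> ` (X \<union> Y)) ` ((set ` set R_family) \<times> (set ` set C_family))"
    unfolding C by (auto simp: image_iff)
  have "inj_on (\<lambda>(X, Y). \<phi> ` (X \<union> Y)) ((set ` set R_family) \<times> (set ` set C_family))"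
    by (rule inj_onI) (auto simp: product_eq_iff)
  then have "card {K. completable 1 C K} = 36"
    unfolding comp by (simp add: card_image card_cartesian_product card_families)
  moreover have "{R \<union> D | R D. R \<in> Rs \<and> D \<in> Cs} = {K. completable 1 C K}"
    unfolding comp Rs Cs by (auto simp: image_Un)
  moreover have "\<forall>R\<in>Rs. \<forall>D\<in>Cs. max_cap (R \<union> D)"
    unfolding Rs Cs using prod_max by (simp add: image_Un)
  ultimately show ?thesis using n1 n2 by blast
qed

end
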